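(* Let $X$ be a (non-Euclidean) analytic normed plane, let $z\in X$ be normal, and let $\mathcal{H}$ be an open half-plane formed by the line through $0$ and $z$. Then there exists a comeagre subset of points $y\in\mathcal{H}$ such that the following holds: for any $t\in\mathbb{T}$, if $r_z(\cdot,t)$ is not an isometry then there exists an open conull subset of $\mathcal{H}$ of points $x$ where $$\|r_z(x,t)-r_z(y,t)\|\neq\|x-y\|.$$
   Context: A normed plane is a $2$-dimensional real normed space. It is analytic if the restriction of its norm to $X\setminus\{0\}$ is a real analytic function (in linear coordinates), and non-Euclidean if its norm does not come from an inner product. Negligible sets: $S\subset O$, with $O$ open, is a conull (resp. comeagre) subset of $O$ if $O\setminus S$ has Lebesgue measure $0$ (resp. is a countable union of nowhere dense sets). Lebesgue measure is taken after identifying the space with $\mathbb{R}^d$. Rotations: $\mathbb{T}=\mathbb{R}/2\pi\mathbb{Z}$ and $S_r[0]=\{x\in X:\|x\|=r\}$. For non-zero $z\in X$ fix an analytic bijection $f:\mathbb{T}\to S_{\|z\|}[0]$ with $f(0)=z$ and $\|f'(t)\|$ constant (there are exactly two such maps, $t\mapsto f(t)$ and $t\mapsto f(-t)$; either choice may be used). Then $r_z:X\times\mathbb{T}\to X$ denotes the unique continuous map with $r_z(z,t)=f(t)$, $r_z(x,0)=x$, $\|r_z(x,t)\|=\|x\|$ and $\|r_z(x,t)-r_z(z,t)\|=\|x-z\|$ for all $x\in X$, $t\in\mathbb{T}$. Normal points: for a finite simple graph $G=(V,E)$ and $p\in X^V$ (a placement; $(G,p)$ is a framework) let $f_G(p)=(\frac12\|p_v-p_w\|^2)_{vw\in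 E}\in\mathbb{R}^E$. The framework $(G,p)$ is well-positioned if $f_G$ is differentiable at $p$ and $p_v\neq p_w$ for all $vw\in E$. It is regular if it is well-positioned and $\operatorname{rank} df_G(p)$ is maximal among well-positioned placements of $G$. It is strongly regular if it is well-positioned and $(G,q)$ is regular for every $q$ with $f_G(q)=f_G(p)$. The placement $p$ (or the framework) is completely strongly regular if for every graph $H$ with vertex set $V$, $(H,p)$ is well-positioned and strongly regular. With $K_4$ the complete graph on $v_0,v_1,v_2,v_3$, a point $z\in X\setminus\{0\}$ is normal if there is a completely strongly regular framework $(K_4,p)$ in $X$ with $p_{v_0}=0$ and $p_{v_1}=z$. *)

theory Defs
  imports "HOL-Analysis.Analysis"
begin

text \<open>
  A normed plane is a type of class \<open>real_normed_vector\<close> with \<open>dim UNIV = 2\<close>. (The class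
  \<open>euclidean_space\<close> would force the norm to come from an inner product.) Linear coordinates are
  linear bijections from \<open>real ^ 2\<close>.
\<close>

definition linear_chart :: "(real ^ 2 \<Rightarrow> 'a::real_normed_vector) \<Rightarrow> bool" where
  "linear_chart \<phi> \<longleftrightarrow> linear \<phi> \<and> bij \<phi>"

text \<open>
  Locally a convergent power series. The exponent vectors are the functions
  \<open>\<alpha> \<in> Basis \<rightarrow>\<^sub>E UNIV\<close>; for the domain \<open>real\<close> (whose basis is \<open>{1}\<close>) this is an ordinary power
  series in one variable.
\<close>

definition real_analytic_at ::
    "('b::euclidean_space \<Rightarrow> 'c::real_normed_vector) \<Rightarrow> 'b \<Rightarrow> bool" where
  "real_analytic_at f x \<longleftrightarrow>
     (\<exists>(c :: ('b \<Rightarrow> nat) \<Rightarrow> 'c) \<rho>. \<rho> > 0 \<and>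
        (\<forall>h. norm h < \<rho> \<longrightarrow>
           ((\<lambda>\<alpha>. (\<Prod>b\<in>Basis. (h \<bullet> b) ^ \<alpha> b) *\<^sub>R c \<alpha>) has_sum f (x + h)) (Basis \<rightarrow>\<^sub>E UNIV)))"

text \<open>Analyticity does not depend on the choice of linear coordinates.\<close>

definition analytic_norm :: "'a::real_normed_vector itself \<Rightarrow> bool" where
  "analytic_norm _ \<longleftrightarrow>
     (\<exists>\<phi> :: real ^ 2 \<Rightarrow> 'a. linear_chart \<phi> \<and>
        (\<forall>u. \<phi> u \<noteq> 0 \<longrightarrow> real_analytic_at (\<lambda>u. norm (\<phi> u)) u))"

definition euclidean_norm :: "'a::real_normed_vector itself \<Rightarrow> bool" where
  "euclidean_norm _ \<longleftrightarrow>
     (\<exists>B :: 'a \<Rightarrow> 'a \<Rightarrow> real. bilinear B \<and> (\<forall>x y. B x y = B y x) \<and> (\<forall>x. B x x = (norm x)\<^sup>2))"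

text \<open>Being Lebesgue null does not depend on the choice of linear coordinates either.\<close>

definition lebesgue_null :: "'a::real_normed_vector set \<Rightarrow> bool" where
  "lebesgue_null S \<longleftrightarrow>
     (\<forall>\<phi> :: real ^ 2 \<Rightarrow> 'a. linear_chart \<phi> \<longrightarrow> \<phi> -` S \<in> null_sets lebesgue)"

definition conull_subset :: "'a::real_normed_vector set \<Rightarrow> 'a set \<Rightarrow> bool" where
  "conull_subset S U \<longleftrightarrow> S \<subseteq> U \<and> lebesgue_null (U - S)"

definition nowhere_dense :: "'a::topological_space set \<Rightarrow> bool" where
  "nowhere_dense S \<longleftrightarrow> interior (closure S) = {}"

definition comeagre_subset :: "'a::topological_space set \<Rightarrow> 'a set \<Rightarrow> bool" where
  "comeagre_subset S U \<longleftrightarrow> S \<subseteq> U \<and>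
     (\<exists>\<T>. countable \<T> \<and> (\<forall>T\<in>\<T>. nowhere_dense T) \<and> U - S = \<Union>\<T>)"

definition open_half_plane :: "'a::real_normed_vector \<Rightarrow> 'a set \<Rightarrow> bool" where
  "open_half_plane z H \<longleftrightarrow>
     (\<exists>l :: 'a \<Rightarrow> real. linear l \<and> {x. l x = 0} = span {z} \<and> H = {x. l x > 0})"


text \<open>
  Maps on the circle group \<open>\<real>/2\<pi>\<int>\<close> are represented by \<open>2\<pi>\<close>-periodic maps on \<open>real\<close>.
\<close>

definition circle_parametrization ::
    "'a::real_normed_vector \<Rightarrow> (real \<Rightarrow> 'a) \<Rightarrow> bool" where
  "circle_parametrization z f \<longleftrightarrow>
     (\<forall>t. f (t + 2 * pi) = f t) \<and>
     bij_betw f {0..<2 * pi} (sphere 0 (norm z)) \<and>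
     (\<forall>t. real_analytic_at f t) \<and>
     f 0 = z \<and>
     (\<exists>k. \<forall>t. norm (vector_derivative f (at t)) = k)"

text \<open>
  For non-zero \<open>z\<close> in an analytic normed plane, the conditions below determine \<open>r\<close> uniquely
  from \<open>z\<close> and \<open>f\<close>.
\<close>

definition rotation_about ::
    "'a::real_normed_vector \<Rightarrow> (real \<Rightarrow> 'a) \<Rightarrow> ('a \<Rightarrow> real \<Rightarrow> 'a) \<Rightarrow> bool" where
  "rotation_about z f r \<longleftrightarrow>
     (\<forall>x t. r x (t + 2 * pi) = r x t) \<and>
     continuous_on UNIV (\<lambda>(x, t). r x t) \<and>
     (\<forall>t. r z t = f t) \<and>
     (\<forall>x. r x 0 = x) \<and>
     (\<forall>x t. norm (r x t) = norm x) \<and>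
     (\<forall>x t. norm (r x t - r z t) = norm (x - z))"

definition is_isometry :: "('a::metric_space \<Rightarrow> 'a) \<Rightarrow> bool" where
  "is_isometry g \<longleftrightarrow> (\<forall>x y. dist (g x) (g y) = dist x y)"


text \<open>
  A finite simple graph has the finite type \<open>'v\<close> as its vertex set and is given by its set of
  edges. A placement is an element of \<open>'a ^ 'v\<close>.
\<close>

definition simple_graph :: "'v::finite set set \<Rightarrow> bool" where
  "simple_graph E \<longleftrightarrow> (\<forall>e\<in>E. card e = 2)"

definition edge_value :: "'a::real_normed_vector ^ 'v \<Rightarrow> 'v set \<Rightarrow> real" where
  "edge_value p e = (THE c. \<exists>v w. e = {v, w} \<and> c = (1/2) * (norm (p $ v - p $ w))\<^sup>2)"

lemma edge_value_pair: "edge_value p {v, w} = (1/2) * (norm (p $ v - p $ w))\<^sup>2"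
  unfolding edge_value_def
  by (rule the_equality) (auto simp: doubleton_eq_iff norm_minus_commute)

text \<open>
  The codomain \<open>\<real>\<^sup>E\<close> is embedded in \<open>real ^ ('v set)\<close> by zero coordinates off \<open>E\<close>; this affects
  neither differentiability nor rank nor the fibres of the map.
\<close>

definition rigidity_map ::
    "'v::finite set set \<Rightarrow> 'a::real_normed_vector ^ 'v \<Rightarrow> real ^ 'v set" where
  "rigidity_map E p = (\<chi> e. if e \<in> E then edge_value p e else 0)"

definition well_positioned ::
    "'v::finite set set \<Rightarrow> 'a::real_normed_vector ^ 'v \<Rightarrow> bool" where
  "well_positioned E p \<longleftrightarrow>
     rigidity_map E differentiable (at p) \<and> (\<forall>v w. {v, w} \<in> E \<longrightarrow> p $ v \<noteq> p $ w)"

definition rigidity_rank ::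
    "'v::finite set set \<Rightarrow> 'a::real_normed_vector ^ 'v \<Rightarrow> nat" where
  "rigidity_rank E p = dim (range (frechet_derivative (rigidity_map E) (at p)))"

definition regular :: "'v::finite set set \<Rightarrow> 'a::real_normed_vector ^ 'v \<Rightarrow> bool" where
  "regular E p \<longleftrightarrow> well_positioned E p \<and>
     (\<forall>q :: 'a ^ 'v. well_positioned E q \<longrightarrow> rigidity_rank E q \<le> rigidity_rank E p)"

definition strongly_regular ::
    "'v::finite set set \<Rightarrow> 'a::real_normed_vector ^ 'v \<Rightarrow> bool" where
  "strongly_regular E p \<longleftrightarrow> well_positioned E p \<and>
     (\<forall>q :: 'a ^ 'v. rigidity_map E q = rigidity_map E p \<longrightarrow> regular E q)"

text \<open>A condition on the placement alone: the graph \<open>E\<close> ranges over all graphs on \<open>'v\<close>.\<close>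

definition completely_strongly_regular :: "'a::real_normed_vector ^ 'v::finite \<Rightarrow> bool" where
  "completely_strongly_regular p \<longleftrightarrow>
     (\<forall>E :: 'v set set. simple_graph E \<longrightarrow> well_positioned E p \<and> strongly_regular E p)"

text \<open>The four vertices of \<open>K\<^sub>4\<close> are the elements \<open>0, 1, 2, 3\<close> of the type \<open>4\<close>.\<close>

definition normal_point :: "'a::real_normed_vector \<Rightarrow> bool" where
  "normal_point z \<longleftrightarrow> z \<noteq> 0 \<and>
     (\<exists>p :: 'a ^ 4. completely_strongly_regular p \<and> p $ 0 = 0 \<and> p $ 1 = z)"

end

theory Submission
  imports Defs "HOL-Complex_Analysis.Conformal_Mappings"
begin

text \<open>
  For \<open>y\<close> in the half-plane \<open>H\<close> put \<open>g x = \<parallel>r x t - r y t\<parallel> - \<parallel>x - y\<parallel>\<close>. The proof shows that for every \<open>y\<close>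
  in \<open>H\<close> and every \<open>t\<close> either the zeros of \<open>g\<close> in \<open>H\<close> form a null set or \<open>r(t)\<close>, the map \<open>x \<mapsto> r x t\<close>, is an
  isometry. So \<open>H\<close> itself is the required comeagre set, and the points of \<open>H\<close> where \<open>g\<close> does not
  vanish form the required open conull set.

  An analytic norm is strictly convex: a segment in the unit circle would, by the identity theorem,
  force the norm to be constant on a line. It follows that \<open>x \<mapsto> (\<parallel>x\<parallel>, \<parallel>x - c\<parallel>)\<close> are regular and injective
  coordinates on either side of the line through \<open>0\<close> and \<open>c\<close> (\<open>bipolar_inj\<close>, \<open>bipolar_has_derivative\<close>), and
  that \<open>r(t)\<close> is the map which takes a point with given coordinates for \<open>c = z\<close> to the point with the same
  coordinates for \<open>c = r z t\<close>. When one of the two coordinates is fixed, the point runs on a circle and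
  depends analytically on the other coordinate, by an inverse function theorem in one variable
  (\<open>bipolar_inverse_analytic_fst\<close>, \<open>bipolar_inverse_analytic_snd\<close>). Therefore \<open>g\<close> is separately analytic in
  these coordinates on \<open>H - {y}\<close>, which is connected. By Fubini and the identity theorem on lines its
  zeros form a null set, or it vanishes identically (\<open>separately_analytic_zeros\<close>).

  In the second case let \<open>L\<close> be the derivative of \<open>r(t)\<close> at \<open>y\<close>. It is a linear isometry since \<open>r(t)\<close>
  preserves distances to \<open>y\<close>. Differentiating \<open>\<parallel>r x t\<parallel> = \<parallel>x\<parallel>\<close> and \<open>\<parallel>r x t - r z t\<parallel> = \<parallel>x - z\<parallel>\<close> at \<open>x = y\<close> and
  using strict convexity gives \<open>L y = r y t\<close> and \<open>L (y - z) = r y t - r z t\<close>, hence \<open>L z = r z t\<close>. So \<open>L\<close>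
  and \<open>r(t)\<close> agree in bipolar coordinates, and \<open>r(t) = L\<close> is an isometry
  (\<open>isometry_if_locally_preserves_distance\<close>).
\<close>

section \<open>Real analytic functions of one variable\<close>

text \<open>
  Real analyticity in one variable, as a holomorphic extension to a complex neighbourhood. In this
  form the closure properties, the inverse function theorem and the identity theorem are inherited
  from complex analysis.
\<close>

definition complexifies :: "(real \<Rightarrow> real) \<Rightarrow> real \<Rightarrow> bool" where
  "complexifies g s \<longleftrightarrow>
     (\<exists>G. G analytic_on {complex_of_real s} \<and>
        (\<forall>\<^sub>F u in nhds s. G (complex_of_real u) = complex_of_real (g u)))"

lemma complexifiesE:
  assumes "complexifies g s"
  obtains G e where "e > 0" "G holomorphic_on ball (complex_of_real s) e"
    "\<And>u. \<bar>u - s\<bar> < e \<Longrightarrow> G (complex_of_real u) = complex_of_real (g u)"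
proof -
  obtain G where G: "G analytic_on {complex_of_real s}"
    and ev: "\<forall>\<^sub>F u in nhds s. G (complex_of_real u) = complex_of_real (g u)"
    using assms unfolding complexifies_def by blast
  obtain e1 where e1: "e1 > 0" "G holomorphic_on ball (complex_of_real s) e1"
    using G by (auto simp: analytic_on_def)
  obtain e2 where e2: "e2 > 0"
    "\<And>u. dist u s < e2 \<Longrightarrow> G (complex_of_real u) = complex_of_real (g u)"
    using ev unfolding eventually_nhds_metric by blast
  show ?thesis
  proof (rule that[of "min e1 e2" G])
    show "G holomorphic_on ball (complex_of_real s) (min e1 e2)"
      by (rule holomorphic_on_subset[OF e1(2)]) auto
  qed (use e1 e2 in \<open>auto simp: dist_real_def\<close>)
qed

lemma complexifies_cong:
  assumes "\<forall>\<^sub>F u in nhds s. g u = h u" "complexifies g s"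
  shows "complexifies h s"
proof -
  obtain G where G: "G analytic_on {complex_of_real s}"
    and ev: "\<forall>\<^sub>F u in nhds s. G (complex_of_real u) = complex_of_real (g u)"
    using assms(2) unfolding complexifies_def by blast
  have "\<forall>\<^sub>F u in nhds s. G (complex_of_real u) = complex_of_real (h u)"
    using ev assms(1) by eventually_elim auto
  with G show ?thesis unfolding complexifies_def by blast
qed

lemma complexifies_const [intro, simp]: "complexifies (\<lambda>_. c) s"
  unfolding complexifies_def by (rule exI[of _ "\<lambda>_. complex_of_real c"]) auto

lemma complexifies_ident [intro, simp]: "complexifies (\<lambda>u. u) s"
  unfolding complexifies_def by (rule exI[of _ "\<lambda>u. u"]) auto

text \<open>
  One scheme for the four arithmetic operations; \<open>Op\<close> is the complex version of \<open>op\<close>. The values of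
  the extensions at \<open>s\<close> are made available because division needs a non-zero denominator there.
\<close>

lemma complexifies_binop:
  assumes "complexifies g s" "complexifies h s"
    and "\<And>G H. \<lbrakk>G analytic_on {complex_of_real s}; H analytic_on {complex_of_real s};
            G (complex_of_real s) = complex_of_real (g s); H (complex_of_real s) = complex_of_real (h s)\<rbrakk>
         \<Longrightarrow> (\<lambda>w. Op (G w) (H w)) analytic_on {complex_of_real s}"
    and "\<And>a b. Op (complex_of_real a) (complex_of_real b) = complex_of_real (op a b)"
  shows "complexifies (\<lambda>u. op (g u) (h u)) s"
proof -
  obtain G H where GH: "G analytic_on {complex_of_real s}" "H analytic_on {complex_of_real s}"
    and ev: "\<forall>\<^sub>F u in nhds s. G (complex_of_real u) = complex_of_real (g u)"
            "\<forall>\<^sub>F u in nhds s. H (complex_of_real u) = complex_of_real (h u)"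
    using assms(1,2) unfolding complexifies_def by blast
  have "(\<lambda>w. Op (G w) (H w)) analytic_on {complex_of_real s}"
    using GH eventually_nhds_x_imp_x[OF ev(1)] eventually_nhds_x_imp_x[OF ev(2)] by (rule assms(3))
  moreover have "\<forall>\<^sub>F u in nhds s. Op (G (of_real u)) (H (of_real u)) = of_real (op (g u) (h u))"
    using ev by eventually_elim (simp add: assms(4))
  ultimately show ?thesis
    unfolding complexifies_def by (intro exI[of _ "\<lambda>w. Op (G w) (H w)"]) simp
qed

lemma complexifies_add:
  "complexifies g s \<Longrightarrow> complexifies h s \<Longrightarrow> complexifies (\<lambda>u. g u + h u) s"
  by (rule complexifies_binop[where Op = "(+)"]) (auto intro: analytic_intros)

lemma complexifies_diff:
  "complexifies g s \<Longrightarrow> complexifies h s \<Longrightarrow> complexifies (\<lambda>u. g u - h u) s"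
  by (rule complexifies_binop[where Op = "(-)"]) (auto intro: analytic_intros)

lemma complexifies_mult:
  "complexifies g s \<Longrightarrow> complexifies h s \<Longrightarrow> complexifies (\<lambda>u. g u * h u) s"
  by (rule complexifies_binop[where Op = "(*)"]) (auto intro: analytic_intros)

lemma complexifies_divide:
  "complexifies g s \<Longrightarrow> complexifies h s \<Longrightarrow> h s \<noteq> 0 \<Longrightarrow> complexifies (\<lambda>u. g u / h u) s"
  by (rule complexifies_binop[where Op = "(/)"]) (auto intro: analytic_intros)

lemma complexifies_compose:
  assumes g: "complexifies g s" and h: "complexifies h (g s)"
  shows "complexifies (\<lambda>u. h (g u)) s"
proof -
  obtain G where G: "G analytic_on {complex_of_real s}"
    and evG: "\<forall>\<^sub>F u in nhds s. G (complex_of_real u) = complex_of_real (g u)"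
    using g unfolding complexifies_def by blast
  obtain H where H: "H analytic_on {complex_of_real (g s)}"
    and evH: "\<forall>\<^sub>F u in nhds (g s). H (complex_of_real u) = complex_of_real (h u)"
    using h unfolding complexifies_def by blast
  have Gs: "G (complex_of_real s) = complex_of_real (g s)"
    using eventually_nhds_x_imp_x[OF evG] .
  have an: "(H \<circ> G) analytic_on {complex_of_real s}"
    by (rule analytic_on_compose[OF G]) (simp add: Gs H)
  have "isCont G (complex_of_real s)"
    using G by (rule analytic_at_imp_isCont)
  then have "(G \<longlongrightarrow> complex_of_real (g s)) (nhds (complex_of_real s))"
    by (metis Gs isCont_def tendsto_at_iff_tendsto_nhds)
  moreover have "(complex_of_real \<longlongrightarrow> complex_of_real s) (nhds s)"
    by (intro tendsto_of_real filterlim_ident)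
  ultimately have "((\<lambda>u. G (complex_of_real u)) \<longlongrightarrow> complex_of_real (g s)) (nhds s)"
    by (rule filterlim_compose)
  then have "((\<lambda>u. Re (G (complex_of_real u))) \<longlongrightarrow> g s) (nhds s)"
    using tendsto_Re by fastforce
  with evH have "\<forall>\<^sub>F u in nhds s. H (complex_of_real (Re (G (of_real u)))) = complex_of_real (h (Re (G (of_real u))))"
    by (rule eventually_compose_filterlim)
  with evG have "\<forall>\<^sub>F u in nhds s. (H \<circ> G) (complex_of_real u) = complex_of_real (h (g u))"
    by eventually_elim simp
  with an show ?thesis unfolding complexifies_def by blast
qed

lemma holomorphic_extension_has_derivative:
  assumes G: "G analytic_on {complex_of_real s}"
    and ev: "\<forall>\<^sub>F u in nhds s. G (complex_of_real u) = complex_of_real (g u)"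
  shows "(g has_real_derivative Re (deriv G (complex_of_real s))) (at s)"
proof -
  have "(G has_field_derivative deriv G (complex_of_real s)) (at (complex_of_real s))"
    using G analytic_on_imp_differentiable_at DERIV_deriv_iff_field_differentiable by blast
  then have "((\<lambda>u. G (complex_of_real u)) has_vector_derivative deriv G (complex_of_real s)) (at s)"
    by (rule has_vector_derivative_real_field)
  then have "((\<lambda>u. Re (G (complex_of_real u))) has_vector_derivative Re (deriv G (complex_of_real s))) (at s)"
    by (rule bounded_linear.has_vector_derivative[OF bounded_linear_Re])
  then have *: "((\<lambda>u. Re (G (complex_of_real u))) has_real_derivative Re (deriv G (complex_of_real s))) (at s)"
    by (simp add: has_real_derivative_iff_has_vector_derivative)
  have "\<forall>\<^sub>F u in nhds s. Re (G (complex_of_real u)) = g u"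
    using ev by eventually_elim simp
  with * show ?thesis
    by (simp add: DERIV_cong_ev)
qed

lemma complexifies_differentiable:
  assumes "complexifies g s"
  obtains d where "(g has_real_derivative d) (at s)"
  using assms holomorphic_extension_has_derivative unfolding complexifies_def by blast

lemma complexifies_isCont: "complexifies g s \<Longrightarrow> isCont g s"
  by (meson DERIV_isCont complexifies_differentiable)

text \<open>
  The holomorphic extension is locally invertible because its derivative at \<open>s\<close> is \<open>d\<close>. Its inverse is
  real on the real axis since \<open>h\<close> is continuous and injective near \<open>s\<close>, hence open.
\<close>

lemma complexifies_inverse_function:
  assumes h: "complexifies h s" and d: "(h has_real_derivative d) (at s)" "d \<noteq> 0"
  obtains \<eta> where "complexifies \<eta> (h s)" "\<eta> (h s) = s" "\<forall>\<^sub>F b in nhds (h s). h (\<eta> b) = b"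
proof -
  obtain e G where e: "e > 0" and G: "G holomorphic_on ball (complex_of_real s) e"
    and Gh: "\<And>u. \<bar>u - s\<bar> < e \<Longrightarrow> G (complex_of_real u) = complex_of_real (h u)"
    by (rule complexifiesE[OF h]) (rule that)
  have "G analytic_on {complex_of_real s}"
    using G e by (auto simp: analytic_at_ball)
  moreover have "\<forall>\<^sub>F u in nhds s. G (complex_of_real u) = complex_of_real (h u)"
    using e Gh unfolding eventually_nhds_metric by (auto simp: dist_real_def)
  ultimately have "(h has_real_derivative Re (deriv G (complex_of_real s))) (at s)"
    by (rule holomorphic_extension_has_derivative)
  then have "deriv G (complex_of_real s) \<noteq> 0"
    using d DERIV_unique by fastforce
  then obtain \<rho> where \<rho>: "\<rho> > 0" "ball (complex_of_real s) \<rho> \<subseteq> ball (complex_of_real s) e"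
      "open (G ` ball (complex_of_real s) \<rho>)" "inj_on G (ball (complex_of_real s) \<rho>)"
    using has_complex_derivative_locally_invertible[OF G, of "complex_of_real s"] e by auto
  have Gr: "G holomorphic_on ball (complex_of_real s) \<rho>"
    using G \<rho>(2) holomorphic_on_subset by blast
  obtain K where K: "K holomorphic_on G ` ball (complex_of_real s) \<rho>"
      "\<And>w. w \<in> ball (complex_of_real s) \<rho> \<Longrightarrow> K (G w) = w"
    using holomorphic_has_inverse[OF Gr open_ball \<rho>(4)] by metis
  define \<eta> where "\<eta> = (\<lambda>b. Re (K (complex_of_real b)))"
  define I where "I = {u. \<bar>u - s\<bar> < \<rho>}"
  have I: "open I" "s \<in> I"
    using \<rho>(1) by (auto simp: I_def intro!: open_Collect_less continuous_intros)
  have Iball: "complex_of_real u \<in> ball (complex_of_real s) \<rho>" if "u \<in> I" for u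
    using that by (simp add: I_def dist_of_real dist_real_def abs_minus_commute)
  have GI: "G (complex_of_real u) = complex_of_real (h u)" if "u \<in> I" for u
  proof -
    have "complex_of_real u \<in> ball (complex_of_real s) e"
      using Iball[OF that] \<rho>(2) by blast
    then have "\<bar>u - s\<bar> < e" by (simp add: dist_of_real dist_real_def abs_minus_commute)
    then show ?thesis by (rule Gh)
  qed
  have KI: "K (complex_of_real (h u)) = complex_of_real u" if "u \<in> I" for u
    using K(2)[OF Iball[OF that]] GI[OF that] by simp
  have "continuous_on I (\<lambda>u. G (complex_of_real u))"
    by (rule continuous_on_compose2[OF holomorphic_on_imp_continuous_on[OF Gr]])
       (auto intro: continuous_intros Iball)
  then have "continuous_on I (\<lambda>u. Re (G (complex_of_real u)))"
    by (intro continuous_intros)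
  then have "continuous_on I h"
    by (rule continuous_on_eq) (simp add: GI)
  moreover have "inj_on h I"
    using KI by (metis inj_onI of_real_eq_iff)
  \<comment> \<open>so \<open>h\<close> takes all real values near \<open>h s\<close> at real arguments, where \<open>K\<close> is real\<close>
  ultimately have hI: "open (h ` I)"
    using I invariance_of_domain by blast
  have ev: "\<forall>\<^sub>F b in nhds (h s). b \<in> h ` I"
    using hI I by (intro eventually_nhds_in_open) auto
  have "K analytic_on {complex_of_real (h s)}"
    using K(1) \<rho>(3) GI[OF I(2)] Iball[OF I(2)]
    by (metis analytic_at image_eqI)
  moreover have "\<forall>\<^sub>F b in nhds (h s). K (complex_of_real b) = complex_of_real (\<eta> b)"
    using ev by eventually_elim (auto simp: \<eta>_def KI)
  ultimately have "complexifies \<eta> (h s)"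
    unfolding complexifies_def by blast
  moreover have "\<eta> (h s) = s" using KI[OF I(2)] by (simp add: \<eta>_def)
  moreover have "\<forall>\<^sub>F b in nhds (h s). h (\<eta> b) = b"
    using ev by eventually_elim (auto simp: \<eta>_def KI)
  ultimately show ?thesis using that by blast
qed

lemma complexifies_locally_zero:
  assumes g: "complexifies g s" and s: "s islimpt {u. g u = 0}"
  shows "\<forall>\<^sub>F u in nhds s. g u = 0"
proof -
  obtain e G where e: "e > 0" and G: "G holomorphic_on ball (complex_of_real s) e"
    and Gg: "\<And>u. \<bar>u - s\<bar> < e \<Longrightarrow> G (complex_of_real u) = complex_of_real (g u)"
    by (rule complexifiesE[OF g]) (rule that)
  define U where "U = complex_of_real ` {u. g u = 0 \<and> \<bar>u - s\<bar> < e}"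
  have "s islimpt {u. g u = 0 \<and> \<bar>u - s\<bar> < e}"
    unfolding islimpt_approachable
  proof (intro allI impI)
    fix d :: real assume "d > 0"
    then have "min d e > 0" using e by simp
    then obtain u where "g u = 0" "u \<noteq> s" "dist u s < min d e"
      using s unfolding islimpt_approachable by blast
    then show "\<exists>x'\<in>{u. g u = 0 \<and> \<bar>u - s\<bar> < e}. x' \<noteq> s \<and> dist x' s < d"
      by (auto simp: dist_real_def)
  qed
  then have lim: "complex_of_real s islimpt U"
    unfolding islimpt_approachable U_def by (simp add: dist_of_real)
  have zero: "G w = 0" if "w \<in> ball (complex_of_real s) e" for w
  proof (rule analytic_continuation[OF G _ _ _ _ lim _ that])
    show "U \<subseteq> ball (complex_of_real s) e"
      unfolding U_def by (clarsimp simp: dist_of_real dist_real_def abs_minus_commute)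
    show "G w = 0" if "w \<in> U" for w
      using that Gg by (auto simp: U_def)
  qed (use e in auto)
  have "g u = 0" if "dist u s < e" for u
    using zero[of "complex_of_real u"] Gg[of u] that
    by (simp add: dist_of_real dist_real_def abs_minus_commute)
  then show ?thesis using e unfolding eventually_nhds_metric by blast
qed

text \<open>
  The points near which \<open>g\<close> vanishes form an open set, and by the complex identity theorem also a
  closed one, since a limit of such points is a limit point of zeros.
\<close>

lemma complexifies_identity_theorem:
  assumes J: "open J" "connected J" and g: "\<And>s. s \<in> J \<Longrightarrow> complexifies g s"
    and a: "a \<in> J" "a islimpt {s. g s = 0}" and s: "s \<in> J"
  shows "g s = 0"
proof -
  define A where "A = {s\<in>J. \<forall>\<^sub>F u in nhds s. g u = 0}"
  have "openin (top_of_set J) A"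
  proof -
    have "open {s. \<forall>\<^sub>F u in nhds s. g u = 0}"
    proof (subst open_subopen, safe)
      fix x assume "\<forall>\<^sub>F u in nhds x. g u = 0"
      then have "\<forall>\<^sub>F y in nhds x. \<forall>\<^sub>F u in nhds y. g u = 0"
        by (subst eventually_eventually)
      then obtain T where "open T" "x \<in> T" "\<forall>y\<in>T. \<forall>\<^sub>F u in nhds y. g u = 0"
        by (metis eventually_nhds)
      then show "\<exists>T. open T \<and> x \<in> T \<and> T \<subseteq> {s. \<forall>\<^sub>F u in nhds s. g u = 0}"
        by blast
    qed
    then show ?thesis
      unfolding A_def by (metis Collect_conj_eq Collect_mem_eq openin_open_Int)
  qed
  moreover have "closedin (top_of_set J) A"
  proof -
    have "x \<in> A" if "x \<in> J" "x islimpt A" for x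
    proof -
      have "x islimpt {s. g s = 0}"
        using that(2) by (rule islimpt_subset) (auto simp: A_def dest: eventually_nhds_x_imp_x)
      then show ?thesis
        using complexifies_locally_zero[OF g] that by (simp add: A_def)
    qed
    then show ?thesis
      by (auto simp: closedin_limpt A_def)
  qed
  moreover have "a \<in> A"
    using complexifies_locally_zero[OF g] a by (simp add: A_def)
  ultimately have "A = J"
    using J(2) unfolding connected_clopen by blast
  then show ?thesis
    using s by (auto simp: A_def dest: eventually_nhds_x_imp_x)
qed

text \<open>
  A convergent power series in several variables also converges at complex arguments, uniformly where
  each coordinate is bounded by the radius divided by twice the dimension. Composed with the
  holomorphic extensions of the coordinates of \<open>p\<close>, it is therefore a locally uniform limit of
  holomorphic functions.
\<close>

lemma complexifies_along_curve:
  fixes N :: "'b::euclidean_space \<Rightarrow> real" and p :: "real \<Rightarrow> 'b"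
  assumes N: "real_analytic_at N (p s)"
    and p: "\<And>b. b \<in> Basis \<Longrightarrow> complexifies (\<lambda>u. p u \<bullet> b) s"
  shows "complexifies (\<lambda>u. N (p u)) s"
proof -
  define A :: "('b \<Rightarrow> nat) set" where "A = (Basis \<rightarrow>\<^sub>E UNIV)"
  obtain c \<rho> where \<rho>: "\<rho> > 0" and N_sum: "\<And>h. norm h < \<rho> \<Longrightarrow>
      ((\<lambda>\<alpha>. (\<Prod>b\<in>Basis. (h \<bullet> b) ^ \<alpha> b) *\<^sub>R c \<alpha>) has_sum N (p s + h)) A"
    using N unfolding real_analytic_at_def A_def by blast
  have "\<forall>b\<in>Basis. \<exists>G. G analytic_on {complex_of_real s} \<and>
      (\<forall>\<^sub>F u in nhds s. G (complex_of_real u) = complex_of_real (p u \<bullet> b))"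
    using p unfolding complexifies_def by blast
  then obtain P where P: "\<And>b. b \<in> Basis \<Longrightarrow> P b analytic_on {complex_of_real s}"
    and evP: "\<And>b. b \<in> Basis \<Longrightarrow>
      \<forall>\<^sub>F u in nhds s. P b (complex_of_real u) = complex_of_real (p u \<bullet> b)"
    by metis
  have Ps: "P b (complex_of_real s) = complex_of_real (p s \<bullet> b)" if "b \<in> Basis" for b
    using evP[OF that] by (rule eventually_nhds_x_imp_x)
  \<comment> \<open>a vector with all coordinates at most \<open>d\<close> has norm below \<open>\<rho>\<close>\<close>
  define d where "d = \<rho> / (2 * DIM('b))"
  have d: "d > 0" "DIM('b) * d < \<rho>"
    using \<rho> by (auto simp: d_def field_simps)
  have "\<forall>\<^sub>F w in nhds (complex_of_real s). P b field_differentiable at w \<and>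
          norm (P b w - complex_of_real (p s \<bullet> b)) < d" if b: "b \<in> Basis" for b
  proof (rule eventually_conj)
    obtain S where S: "open S" "complex_of_real s \<in> S" "P b holomorphic_on S"
      using P[OF b] unfolding analytic_at by blast
    then show "\<forall>\<^sub>F w in nhds (complex_of_real s). P b field_differentiable at w"
      by (metis (mono_tags, lifting) eventually_nhds holomorphic_on_imp_differentiable_at)
    have "(P b \<longlongrightarrow> complex_of_real (p s \<bullet> b)) (nhds (complex_of_real s))"
      using analytic_at_imp_isCont[OF P[OF b]] Ps[OF b]
      by (metis isCont_def tendsto_at_iff_tendsto_nhds)
    then show "\<forall>\<^sub>F w in nhds (complex_of_real s). norm (P b w - complex_of_real (p s \<bullet> b)) < d"
      using d(1) by (auto simp: tendsto_iff dist_norm)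
  qed
  then have "\<forall>\<^sub>F w in nhds (complex_of_real s). \<forall>b\<in>Basis. P b field_differentiable at w \<and>
          norm (P b w - complex_of_real (p s \<bullet> b)) < d"
    by (intro eventually_ball_finite) auto
  then obtain e where e: "e > 0" and eP: "\<And>w b. dist w (complex_of_real s) < e \<Longrightarrow> b \<in> Basis \<Longrightarrow>
      P b field_differentiable at w \<and> norm (P b w - complex_of_real (p s \<bullet> b)) < d"
    unfolding eventually_nhds_metric by blast
  define e' where "e' = e / 2"
  have e': "0 < e'" "e' < e" using e by (auto simp: e'_def)
  define T where "T = (\<lambda>\<alpha> w. (\<Prod>b\<in>Basis. (P b w - complex_of_real (p s \<bullet> b)) ^ \<alpha> b) * complex_of_real (c \<alpha>))"
  define M where "M = (\<lambda>\<alpha>. norm ((\<Prod>b\<in>(Basis :: 'b set). d ^ \<alpha> b) *\<^sub>R c \<alpha>))"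
  have T_hol: "T \<alpha> holomorphic_on ball (complex_of_real s) e" for \<alpha>
  proof -
    have "P b holomorphic_on ball (complex_of_real s) e" if "b \<in> Basis" for b
      using eP that by (auto simp: holomorphic_on_def dist_commute intro: field_differentiable_at_within)
    then show ?thesis
      unfolding T_def by (intro holomorphic_intros)
  qed
  have "M summable_on A"
  proof -
    define h where "h = (\<Sum>b\<in>(Basis :: 'b set). d *\<^sub>R b)"
    have hb: "h \<bullet> b = d" if "b \<in> Basis" for b
      using that by (simp add: h_def)
    have "norm h \<le> (\<Sum>b\<in>Basis. \<bar>h \<bullet> b\<bar>)" by (rule norm_le_l1)
    also have "\<dots> = DIM('b) * d" using d(1) by (simp add: hb)
    finally have "norm h < \<rho>" using d(2) by simp
    from N_sum[OF this] have "(\<lambda>\<alpha>. (\<Prod>b\<in>Basis. (h \<bullet> b) ^ \<alpha> b) *\<^sub>R c \<alpha>) summable_on A"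
      by (rule has_sum_imp_summable)
    then have "(\<lambda>\<alpha>. (\<Prod>b\<in>(Basis :: 'b set). d ^ \<alpha> b) *\<^sub>R c \<alpha>) summable_on A"
      by (simp add: hb)
    then show ?thesis
      unfolding M_def by (rule summable_on_iff_abs_summable_on_real[THEN iffD1])
  qed
  moreover have "norm (T \<alpha> w) \<le> M \<alpha>" if "w \<in> cball (complex_of_real s) e'" for \<alpha> w
  proof -
    have w: "dist w (complex_of_real s) < e" using that e' by (auto simp: dist_commute)
    have "norm (\<Prod>b\<in>Basis. (P b w - complex_of_real (p s \<bullet> b)) ^ \<alpha> b) \<le> (\<Prod>b\<in>(Basis::'b set). d ^ \<alpha> b)"
      unfolding prod_norm[symmetric] norm_power
      using eP[OF w] by (intro prod_mono conjI power_mono) (auto intro: less_imp_le)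
    then show ?thesis
      using d(1) unfolding T_def M_def
      by (auto simp: norm_mult abs_mult abs_prod intro!: mult_right_mono)
  qed
  ultimately have "uniform_limit (cball (complex_of_real s) e') (\<lambda>X w. \<Sum>\<alpha>\<in>X. T \<alpha> w)
      (\<lambda>w. \<Sum>\<^sub>\<infinity>\<alpha>\<in>A. T \<alpha> w) (finite_subsets_at_top A)"
    by (intro Weierstrass_m_test_general)
  then have "(\<lambda>w. \<Sum>\<^sub>\<infinity>\<alpha>\<in>A. T \<alpha> w) holomorphic_on ball (complex_of_real s) e'"
  proof (rule holomorphic_uniform_limit[rotated])
    have "(\<lambda>w. \<Sum>\<alpha>\<in>X. T \<alpha> w) holomorphic_on ball (complex_of_real s) e" for X
      using T_hol by (intro holomorphic_intros)
    moreover have "cball (complex_of_real s) e' \<subseteq> ball (complex_of_real s) e"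
      using e' by auto
    ultimately have hol: "(\<lambda>w. \<Sum>\<alpha>\<in>X. T \<alpha> w) holomorphic_on cball (complex_of_real s) e'" for X
      using holomorphic_on_subset by blast
    show "\<forall>\<^sub>F X in finite_subsets_at_top A.
        continuous_on (cball (complex_of_real s) e') (\<lambda>w. \<Sum>\<alpha>\<in>X. T \<alpha> w) \<and>
        (\<lambda>w. \<Sum>\<alpha>\<in>X. T \<alpha> w) holomorphic_on ball (complex_of_real s) e'"
      by (intro always_eventually allI conjI holomorphic_on_imp_continuous_on)
        (rule hol holomorphic_on_subset[OF hol ball_subset_cball])+
  qed auto
  then have "(\<lambda>w. \<Sum>\<^sub>\<infinity>\<alpha>\<in>A. T \<alpha> w) analytic_on {complex_of_real s}"
    using e' by (auto simp: analytic_at_ball)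
  moreover have "\<forall>\<^sub>F u in nhds s. (\<Sum>\<^sub>\<infinity>\<alpha>\<in>A. T \<alpha> (complex_of_real u)) = complex_of_real (N (p u))"
  proof -
    have "\<forall>\<^sub>F u in nhds s. \<forall>b\<in>Basis. P b (complex_of_real u) = complex_of_real (p u \<bullet> b)"
      using evP by (intro eventually_ball_finite) auto
    moreover have "\<forall>\<^sub>F u in nhds s. dist u s < e"
      using e by (auto simp: eventually_nhds_metric)
    ultimately show ?thesis
    proof eventually_elim
      case (elim u)
      have near: "\<bar>(p u - p s) \<bullet> b\<bar> < d" if "b \<in> Basis" for b
        using eP[of "complex_of_real u" b] elim that
        by (simp add: dist_of_real inner_diff_left flip: of_real_diff)
      have "norm (p u - p s) \<le> (\<Sum>b\<in>Basis. \<bar>(p u - p s) \<bullet> b\<bar>)" by (rule norm_le_l1)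
      also have "\<dots> \<le> (\<Sum>b\<in>(Basis :: 'b set). d)"
        using near by (intro sum_mono) (auto intro: less_imp_le)
      also have "\<dots> < \<rho>" using d(2) by simp
      finally have "((\<lambda>\<alpha>. (\<Prod>b\<in>Basis. ((p u - p s) \<bullet> b) ^ \<alpha> b) *\<^sub>R c \<alpha>) has_sum N (p u)) A"
        using N_sum[of "p u - p s"] by simp
      then have "((\<lambda>\<alpha>. complex_of_real ((\<Prod>b\<in>Basis. ((p u - p s) \<bullet> b) ^ \<alpha> b) *\<^sub>R c \<alpha>)) has_sum
          complex_of_real (N (p u))) A"
        by (simp only: has_sum_of_real_iff)
      also have "(\<lambda>\<alpha>. complex_of_real ((\<Prod>b\<in>Basis. ((p u - p s) \<bullet> b) ^ \<alpha> b) *\<^sub>R c \<alpha>)) =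
          (\<lambda>\<alpha>. T \<alpha> (complex_of_real u))"
        using elim by (simp add: T_def inner_diff_left)
      finally show ?case by (rule infsumI)
    qed
  qed
  ultimately show ?thesis
    unfolding complexifies_def by blast
qed

section \<open>Zeros of separately analytic functions\<close>

text \<open>
  \<open>J\<close> is a countable union of compact sets, so one of these contains infinitely many zeros, which
  accumulate in \<open>J\<close>.
\<close>

lemma complexifies_zero_if_uncountable_zeros:
  assumes J: "open J" "connected J" and g: "\<And>s. s \<in> J \<Longrightarrow> complexifies g s"
    and zeros: "uncountable {s\<in>J. g s = 0}"
  shows "\<forall>s\<in>J. g s = 0"
proof -
  obtain B where B: "countable B" "(\<Union>I\<in>B. I) = J" "\<And>I. I \<in> B \<Longrightarrow> compact I"
  proof -
    obtain K where "\<And>n::nat. compact (K n)" "\<Union>(range K) = J"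
      using open_Union_compact_subsets[OF J(1)] by metis
    then show thesis using that[of "range K"] by auto
  qed
  have "\<exists>I\<in>B. uncountable (I \<inter> {s. g s = 0})"
  proof (rule ccontr)
    assume "\<not> ?thesis"
    then have "countable (\<Union>I\<in>B. I \<inter> {s. g s = 0})"
      using B(1) by (intro countable_UN) auto
    moreover have "(\<Union>I\<in>B. I \<inter> {s. g s = 0}) = {s\<in>J. g s = 0}"
      using B(2) by auto
    ultimately show False using zeros by simp
  qed
  then obtain I where I: "I \<in> B" "infinite (I \<inter> {s. g s = 0})"
    using countable_finite by blast
  then obtain a where a: "a \<in> I" "a islimpt I \<inter> {s. g s = 0}"
    using B(3)[OF I(1)] compact_eq_Bolzano_Weierstrass by (metis inf_le1)
  then have "a \<in> J" "a islimpt {s. g s = 0}"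
    using I(1) B(2) by (auto elim: islimpt_subset)
  then show ?thesis
    using complexifies_identity_theorem[OF J g] by blast
qed

lemma null_set_of_countable_slices:
  fixes E :: "(real \<times> real) set"
  assumes E: "E \<in> sets borel" and slices: "countable {a. uncountable {b. (a, b) \<in> E}}"
  shows "E \<in> null_sets lborel"
proof -
  interpret lborel_pair: pair_sigma_finite "lborel :: real measure" "lborel :: real measure" ..
  have E': "E \<in> sets (lborel \<Otimes>\<^sub>M lborel)"
    using E by (metis lborel_prod sets_lborel)
  have "emeasure lborel E = emeasure (lborel \<Otimes>\<^sub>M lborel) E"
    by (simp add: lborel_prod)
  also have "\<dots> = (\<integral>\<^sup>+a. emeasure lborel (Pair a -` E) \<partial>lborel)"
    by (rule lborel.emeasure_pair_measure_alt[OF E'])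
  also have "\<dots> = (\<integral>\<^sup>+(a::real). 0 \<partial>lborel)"
  proof (rule nn_integral_cong_AE)
    have "AE a in lborel. a \<notin> {a. uncountable {b. (a, b) \<in> E}}"
      using countable_imp_null_set_lborel[OF slices] by (rule AE_not_in)
    then show "AE a in lborel. emeasure lborel (Pair a -` E) = 0"
    proof eventually_elim
      case (elim a)
      then have "countable (Pair a -` E)" by (simp add: vimage_def)
      then show ?case by (rule emeasure_lborel_countable)
    qed
  qed
  finally show ?thesis using E by (auto simp: null_sets_def)
qed

text \<open>
  If \<open>g a\<close> has uncountably many zeros for only countably many \<open>a\<close>, the zero set is null by Fubini.
  Otherwise \<open>g a\<close> vanishes identically for uncountably many \<open>a\<close>; then each function \<open>\<lambda>u. g u b\<close> has
  uncountably many zeros and vanishes identically too. Separate analyticity is the convenient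
  hypothesis because it concerns functions of one variable only.
\<close>

lemma separately_analytic_box:
  fixes g :: "real \<Rightarrow> real \<Rightarrow> real"
  assumes I: "open I" "connected I" and J: "open J" "connected J"
    and fst_an: "\<And>a b. a \<in> I \<Longrightarrow> b \<in> J \<Longrightarrow> complexifies (\<lambda>u. g u b) a"
    and snd_an: "\<And>a b. a \<in> I \<Longrightarrow> b \<in> J \<Longrightarrow> complexifies (\<lambda>v. g a v) b"
    and cont: "continuous_on (I \<times> J) (\<lambda>(a, b). g a b)"
  shows "(\<forall>a\<in>I. \<forall>b\<in>J. g a b = 0) \<or> negligible {(a, b) \<in> I \<times> J. g a b = 0}"
proof (cases "countable {a\<in>I. uncountable {b\<in>J. g a b = 0}}")
  case True
  define E where "E = {(a, b) \<in> I \<times> J. g a b = 0}"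
  have IJ: "open (I \<times> J)" using I J by (intro open_Times)
  then have "open ((I \<times> J) \<inter> (\<lambda>(a, b). g a b) -` (- {0}))"
    by (intro continuous_open_preimage[OF cont]) auto
  moreover have "E = (I \<times> J) - ((I \<times> J) \<inter> (\<lambda>(a, b). g a b) -` (- {0}))"
    by (auto simp: E_def)
  ultimately have "E \<in> sets borel"
    using IJ by auto
  moreover have "{b. (a, b) \<in> E} = (if a \<in> I then {b\<in>J. g a b = 0} else {})" for a
    by (auto simp: E_def)
  then have "{a. uncountable {b. (a, b) \<in> E}} \<subseteq> {a\<in>I. uncountable {b\<in>J. g a b = 0}}"
    by (auto split: if_splits)
  then have "countable {a. uncountable {b. (a, b) \<in> E}}"
    using True by (rule countable_subset)
  ultimately have "E \<in> null_sets lborel"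
    by (rule null_set_of_countable_slices)
  then show ?thesis
    unfolding E_def by (simp add: negligible_iff_null_sets null_sets_completionI)
next
  case False
  define A where "A = {a\<in>I. uncountable {b\<in>J. g a b = 0}}"
  have A0: "g a b = 0" if "a \<in> A" "b \<in> J" for a b
    using that complexifies_zero_if_uncountable_zeros[OF J snd_an, of a] by (auto simp: A_def)
  have "g a b = 0" if "a \<in> I" "b \<in> J" for a b
  proof -
    have "A \<subseteq> I" by (auto simp: A_def)
    then have "A \<subseteq> {a\<in>I. g a b = 0}" using A0[OF _ that(2)] by blast
    moreover have "uncountable A" using False by (simp add: A_def)
    ultimately have "uncountable {a\<in>I. g a b = 0}"
      using countable_subset by blast
    then show ?thesis
      using complexifies_zero_if_uncountable_zeros[OF I fst_an[OF _ that(2)]] that by blast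
  qed
  then show ?thesis by blast
qed

text \<open>
  The alternative on boxes is propagated by connectedness: the points with a neighbourhood on which
  \<open>g\<close> vanishes and those with a neighbourhood in which its zeros are negligible form disjoint open
  sets covering \<open>\<Omega>\<close>.
\<close>

lemma separately_analytic_zeros:
  fixes \<Omega> :: "(real \<times> real) set" and g :: "real \<times> real \<Rightarrow> real"
  assumes \<Omega>: "open \<Omega>" "connected \<Omega>"
    and fst_an: "\<And>a b. (a, b) \<in> \<Omega> \<Longrightarrow> complexifies (\<lambda>u. g (u, b)) a"
    and snd_an: "\<And>a b. (a, b) \<in> \<Omega> \<Longrightarrow> complexifies (\<lambda>v. g (a, v)) b"
    and cont: "continuous_on \<Omega> g"
  shows "(\<forall>p\<in>\<Omega>. g p = 0) \<or> negligible {p\<in>\<Omega>. g p = 0}"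
proof -
  have box: "\<exists>B. open B \<and> p \<in> B \<and> B \<subseteq> \<Omega> \<and> ((\<forall>q\<in>B. g q = 0) \<or> negligible {q\<in>B. g q = 0})"
    if "p \<in> \<Omega>" for p
  proof -
    obtain a b where p: "p = (a, b)" by fastforce
    obtain U V where UV: "open U" "open V" "p \<in> U \<times> V" "U \<times> V \<subseteq> \<Omega>"
      using open_prod_elim[OF \<Omega>(1) \<open>p \<in> \<Omega>\<close>] by metis
    obtain d where d: "d > 0" "ball a d \<subseteq> U" using UV p by (auto simp: open_contains_ball)
    obtain e where e: "e > 0" "ball b e \<subseteq> V" using UV p by (auto simp: open_contains_ball)
    have sub: "ball a d \<times> ball b e \<subseteq> \<Omega>" using d e UV by blast
    have "(\<forall>u\<in>ball a d. \<forall>v\<in>ball b e. g (u, v) = 0) \<or>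
        negligible {(u, v) \<in> ball a d \<times> ball b e. g (u, v) = 0}"
      by (rule separately_analytic_box)
        (use sub in \<open>auto intro!: continuous_on_subset[OF cont] fst_an snd_an simp: case_prod_unfold simp del: mem_ball\<close>)
    moreover have "{(u, v) \<in> ball a d \<times> ball b e. g (u, v) = 0} = {q \<in> ball a d \<times> ball b e. g q = 0}"
      by auto
    ultimately show ?thesis
      using sub p d e by (intro exI[of _ "ball a d \<times> ball b e"]) (auto intro: open_Times)
  qed
  define Z where "Z = \<Union>{B. open B \<and> B \<subseteq> \<Omega> \<and> (\<forall>q\<in>B. g q = 0)}"
  define W where "W = \<Union>{B. open B \<and> B \<subseteq> \<Omega> \<and> negligible {q\<in>B. g q = 0}}"
  have open_ZW: "open Z" "open W" unfolding Z_def W_def by auto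
  have cover: "Z \<union> W = \<Omega>"
  proof
    show "Z \<union> W \<subseteq> \<Omega>" by (auto simp: Z_def W_def)
    show "\<Omega> \<subseteq> Z \<union> W"
    proof
      fix p assume "p \<in> \<Omega>"
      from box[OF this] show "p \<in> Z \<union> W"
        unfolding Z_def W_def by (elim exE conjE disjE) blast+
    qed
  qed
  have "Z \<inter> W = {}"
  proof (rule ccontr)
    assume "Z \<inter> W \<noteq> {}"
    then obtain B C where BC: "open B" "\<forall>q\<in>B. g q = 0" "open C" "negligible {q\<in>C. g q = 0}" "B \<inter> C \<noteq> {}"
      unfolding Z_def W_def by blast
    then have "negligible (B \<inter> C)" by (elim negligible_subset) auto
    then show False using BC open_not_negligible by blast
  qed
  then consider "Z = {}" | "W = {}"
    using connectedD[OF \<Omega>(2) open_ZW] cover by blast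
  then show ?thesis
  proof cases
    case 1
    have "negligible {p\<in>\<Omega>. g p = 0}"
    proof (subst locally_negligible_alt, intro ballI)
      fix p assume p: "p \<in> {p\<in>\<Omega>. g p = 0}"
      then have "p \<in> W" using cover 1 by auto
      then obtain B where B: "open B" "B \<subseteq> \<Omega>" "negligible {q\<in>B. g q = 0}" "p \<in> B"
        unfolding W_def by blast
      have "{q\<in>B. g q = 0} = {p\<in>\<Omega>. g p = 0} \<inter> B" using B by auto
      then show "\<exists>U. openin (top_of_set {p\<in>\<Omega>. g p = 0}) U \<and> p \<in> U \<and> negligible U"
        using B p by (intro exI[of _ "{q\<in>B. g q = 0}"]) (auto simp: openin_open_Int)
    qed
    then show ?thesis ..
  next
    case 2
    then show ?thesis using cover unfolding Z_def by blast
  qed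
qed

section \<open>Analytic norms on the plane\<close>

text \<open>
  The determinant of two vectors of the plane. Its sign tells the two sides of the line through \<open>0\<close> and
  \<open>u\<close> apart.
\<close>

definition wedge :: "real ^ 2 \<Rightarrow> real ^ 2 \<Rightarrow> real" where
  "wedge u v = u $ 1 * v $ 2 - u $ 2 * v $ 1"

lemma wedge_add_left: "wedge (u + v) w = wedge u w + wedge v w"
  and wedge_add_right: "wedge w (u + v) = wedge w u + wedge w v"
  and wedge_diff_left: "wedge (u - v) w = wedge u w - wedge v w"
  and wedge_diff_right: "wedge w (u - v) = wedge w u - wedge w v"
  and wedge_scale_left: "wedge (s *\<^sub>R u) v = s * wedge u v"
  and wedge_scale_right: "wedge u (s *\<^sub>R v) = s * wedge u v"
  and wedge_minus_left: "wedge (- u) v = - wedge u v"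
  and wedge_minus_right: "wedge u (- v) = - wedge u v"
  and wedge_self: "wedge u u = 0"
  and wedge_zero: "wedge 0 u = 0" "wedge u 0 = 0"
  by (simp_all add: wedge_def algebra_simps)

lemmas wedge_simps = wedge_add_left wedge_add_right wedge_diff_left wedge_diff_right
  wedge_scale_left wedge_scale_right wedge_minus_left wedge_minus_right wedge_self wedge_zero

lemma wedge_commute: "wedge v u = - wedge u v"
  by (simp add: wedge_def)

lemma wedge_decompose:
  assumes "wedge u v \<noteq> 0"
  shows "w = (wedge w v / wedge u v) *\<^sub>R u + (wedge u w / wedge u v) *\<^sub>R v"
proof -
  have "wedge u v *\<^sub>R w = wedge w v *\<^sub>R u + wedge u w *\<^sub>R v"
    by (simp add: vec_eq_iff forall_2 wedge_def algebra_simps)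
  then have "(1 / wedge u v) *\<^sub>R (wedge u v *\<^sub>R w) = (1 / wedge u v) *\<^sub>R (wedge w v *\<^sub>R u + wedge u w *\<^sub>R v)"
    by simp
  then show ?thesis
    using assms by (simp add: scaleR_add_right)
qed

lemma wedge_eq_0D:
  assumes "wedge u v = 0" "u \<noteq> 0"
  obtains s where "v = s *\<^sub>R u"
proof (cases "u $ 1 = 0")
  case True
  then have "u $ 2 \<noteq> 0" using assms(2) by (auto simp: vec_eq_iff forall_2)
  then have "v = (v $ 2 / u $ 2) *\<^sub>R u"
    using assms(1) True by (auto simp: vec_eq_iff forall_2 wedge_def)
  then show ?thesis by (rule that)
next
  case False
  then have "v = (v $ 1 / u $ 1) *\<^sub>R u"
    using assms(1) by (auto simp: vec_eq_iff forall_2 wedge_def field_simps)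
  then show ?thesis by (rule that)
qed

lemma continuous_on_wedge [continuous_intros]:
  "continuous_on S f \<Longrightarrow> continuous_on S g \<Longrightarrow> continuous_on S (\<lambda>x. wedge (f x) (g x))"
  unfolding wedge_def by (intro continuous_intros)

lemma convex_wedge_side: "convex {x. k * wedge c x > 0}"
proof -
  have "k * wedge c x = (vector [- k * c $ 2, k * c $ 1] :: real ^ 2) \<bullet> x" for x
    by (simp add: wedge_def inner_vec_def sum_2 algebra_simps)
  then show ?thesis by (simp add: convex_halfspace_gt)
qed

lemma open_wedge_side: "open {x. k * wedge c x > 0}"
  by (intro open_Collect_less continuous_intros)

text \<open>
  A norm on the coordinate plane. Analyticity is stated along analytic curves, because the
  functions to which it is applied depend on one real variable.
\<close>

locale analytic_plane_norm =
  fixes N :: "real ^ 2 \<Rightarrow> real"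
  assumes N_eq_0_iff [simp]: "N u = 0 \<longleftrightarrow> u = 0"
    and N_scale: "N (s *\<^sub>R u) = \<bar>s\<bar> * N u"
    and N_triangle: "N (u + v) \<le> N u + N v"
    and N_curve: "\<lbrakk>\<And>i. complexifies (\<lambda>t. p t $ i) s; p s \<noteq> 0\<rbrakk> \<Longrightarrow> complexifies (\<lambda>t. N (p t)) s"
begin

lemma N_minus [simp]: "N (- u) = N u"
  using N_scale[of "-1" u] by simp

lemma N_minus_commute: "N (u - v) = N (v - u)"
  by (metis N_minus minus_diff_eq)

lemma N_zero [simp]: "N 0 = 0"
  by simp

lemma N_nonneg [simp]: "N u \<ge> 0"
  using N_triangle[of u "- u"] by (simp del: N_eq_0_iff)

lemma N_pos: "u \<noteq> 0 \<Longrightarrow> N u > 0"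
  by (simp add: less_le)

lemma N_line:
  assumes "u + s *\<^sub>R v \<noteq> 0"
  shows "complexifies (\<lambda>t. N (u + t *\<^sub>R v)) s"
  using assms
  by (intro N_curve) (auto intro!: complexifies_add complexifies_mult)

text \<open>
  Analyticity along the coordinate axes gives the two partial derivatives. Convexity turns them into
  a total derivative: \<open>u + v\<close> is the midpoint of two points displaced from \<open>u\<close> along the axes, which
  bounds \<open>N (u + v)\<close> from above, and \<open>u\<close> is the midpoint of \<open>u + v\<close> and \<open>u - v\<close>, which then bounds it
  from below.
\<close>

lemma N_differentiable:
  assumes "u \<noteq> 0"
  shows "N differentiable (at u)"
proof -
  have "\<exists>d. ((\<lambda>t. N (u + t *\<^sub>R axis i 1)) has_real_derivative d) (at 0)" for i
    using complexifies_differentiable[OF N_line[of u 0 "axis i 1"]] assms by auto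
  then obtain d where d: "\<And>i. ((\<lambda>t. N (u + t *\<^sub>R axis i 1)) has_real_derivative d i) (at 0)"
    by metis
  define L where "L = (\<lambda>v :: real ^ 2. d 1 * v $ 1 + d 2 * v $ 2)"
  have "bounded_linear L"
    unfolding L_def
    by (intro bounded_linear_add bounded_linear_const_mult bounded_linear_vec_nth)
  moreover have "\<exists>\<delta>>0. \<forall>v. norm (v - u) < \<delta> \<longrightarrow> norm (N v - N u - L (v - u)) \<le> e * norm (v - u)"
    if e: "e > 0" for e
  proof -
    have "\<exists>\<delta>>0. \<forall>t. \<bar>t\<bar> < \<delta> \<longrightarrow> \<bar>N (u + t *\<^sub>R axis i 1) - N u - d i * t\<bar> \<le> (e/2) * \<bar>t\<bar>" for i
      using d[of i] e unfolding has_field_derivative_def has_derivative_at_alt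
      by (metis (no_types, lifting) add.right_neutral diff_zero half_gt_zero real_norm_def scale_zero_left)
    then obtain \<delta> where \<delta>: "\<And>i. \<delta> i > 0" "\<And>i t. \<bar>t\<bar> < \<delta> i \<Longrightarrow>
        \<bar>N (u + t *\<^sub>R axis i 1) - N u - d i * t\<bar> \<le> (e/2) * \<bar>t\<bar>"
      by metis
    define \<delta>' where "\<delta>' = min (\<delta> 1) (\<delta> 2) / 2"
    have upper: "N (u + v) - N u - L v \<le> e * norm v" if v: "norm v < \<delta>'" for v
    proof -
      have small: "\<bar>2 * v $ 1\<bar> < \<delta> 1" "\<bar>2 * v $ 2\<bar> < \<delta> 2"
        using component_le_norm_cart[of v 1] component_le_norm_cart[of v 2] v
        by (auto simp: \<delta>'_def)
      have "u + v = (1/2) *\<^sub>R (u + (2 * v $ 1) *\<^sub>R axis 1 1) + (1/2) *\<^sub>R (u + (2 * v $ 2) *\<^sub>R axis 2 1)"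
        by (simp add: vec_eq_iff forall_2 axis_def field_simps)
      then have "N (u + v) \<le> (1/2) * N (u + (2 * v $ 1) *\<^sub>R axis 1 1) + (1/2) * N (u + (2 * v $ 2) *\<^sub>R axis 2 1)"
        by (metis N_scale N_triangle abs_of_pos half_gt_zero zero_less_one)
      also have "\<dots> \<le> N u + L v + (e/2) * (\<bar>v $ 1\<bar> + \<bar>v $ 2\<bar>)"
        using \<delta>(2)[OF small(1)] \<delta>(2)[OF small(2)] by (simp add: L_def abs_le_iff field_simps abs_mult)
      also have "(e/2) * (\<bar>v $ 1\<bar> + \<bar>v $ 2\<bar>) \<le> (e/2) * (norm v + norm v)"
        using component_le_norm_cart[of v 1] component_le_norm_cart[of v 2] e
        by (intro mult_left_mono) auto
      finally show ?thesis by simp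
    qed
    have "norm (N v - N u - L (v - u)) \<le> e * norm (v - u)" if v: "norm (v - u) < \<delta>'" for v
    proof -
      have "2 *\<^sub>R u = v + (u + (u - v))" by (simp add: scaleR_2)
      then have "2 * N u \<le> N v + N (u + (u - v))"
        by (metis N_scale N_triangle abs_numeral)
      moreover have "N (u + (u - v)) - N u + L (v - u) \<le> e * norm (v - u)"
        using upper[of "u - v"] v by (simp add: norm_minus_commute L_def algebra_simps)
      ultimately show ?thesis
        using upper[OF v] by (simp add: abs_le_iff)
    qed
    moreover have "\<delta>' > 0" using \<delta>(1) by (simp add: \<delta>'_def)
    ultimately show ?thesis by blast
  qed
  ultimately have "(N has_derivative L) (at u)"
    unfolding has_derivative_at_alt by blast
  then show ?thesis by (auto simp: differentiable_def)
qed

text \<open>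
  The supporting functional of the norm at \<open>u\<close>: it has dual norm \<open>1\<close> and takes the value \<open>N u\<close> at \<open>u\<close>.
\<close>

definition dN :: "real ^ 2 \<Rightarrow> real ^ 2 \<Rightarrow> real" where
  "dN u = frechet_derivative N (at u)"

lemma N_has_derivative: "u \<noteq> 0 \<Longrightarrow> (N has_derivative dN u) (at u)"
  using N_differentiable unfolding dN_def by (simp add: frechet_derivative_works)

lemma dN_linear: "u \<noteq> 0 \<Longrightarrow> linear (dN u)"
  using N_has_derivative has_derivative_linear by blast

lemma isCont_N: "isCont N u"
proof (cases "u = 0")
  case False
  then show ?thesis using N_differentiable differentiable_imp_continuous_within by blast
next
  case True
  define K where "K = N (axis 1 1) + N (axis 2 1)"
  have "N v \<le> norm v * K" for v :: "real ^ 2"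
  proof -
    have "v = v $ 1 *\<^sub>R axis 1 1 + v $ 2 *\<^sub>R axis 2 1"
      by (simp add: vec_eq_iff forall_2 axis_def)
    then have "N v \<le> \<bar>v $ 1\<bar> * N (axis 1 1) + \<bar>v $ 2\<bar> * N (axis 2 1)"
      by (metis N_scale N_triangle)
    also have "\<dots> \<le> norm v * N (axis 1 1) + norm v * N (axis 2 1)"
      by (intro add_mono mult_right_mono component_le_norm_cart N_nonneg)
    finally show ?thesis by (simp add: K_def algebra_simps)
  qed
  moreover have "((\<lambda>v :: real ^ 2. norm v * K) \<longlongrightarrow> 0) (at 0)"
    by (rule tendsto_eq_intros refl | simp)+
  ultimately have "(N \<longlongrightarrow> 0) (at 0)"
    by (intro tendsto_sandwich[of "\<lambda>_. 0" N]) auto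
  then show ?thesis
    using True by (simp add: isCont_def del: N_eq_0_iff)
qed

lemma continuous_on_N [continuous_intros]:
  "continuous_on S f \<Longrightarrow> continuous_on S (\<lambda>x. N (f x))"
  by (rule continuous_on_compose2[of UNIV N])
    (auto intro: continuous_at_imp_continuous_on isCont_N)

lemma N_along_curve:
  assumes "(p has_vector_derivative p') (at s)" "p s \<noteq> 0"
  shows "((\<lambda>t. N (p t)) has_real_derivative dN (p s) p') (at s)"
proof -
  have "((\<lambda>t. N (p t)) has_derivative (\<lambda>x. dN (p s) (x *\<^sub>R p'))) (at s)"
    using has_derivative_compose[OF assms(1)[unfolded has_vector_derivative_def] N_has_derivative[OF assms(2)]] .
  moreover have "(\<lambda>x. dN (p s) (x *\<^sub>R p')) = (*) (dN (p s) p')"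
    using dN_linear[OF assms(2)] by (auto simp: linear_cmul)
  ultimately show ?thesis by (simp add: has_field_derivative_def)
qed

lemma N_along_line:
  assumes "u \<noteq> 0"
  shows "((\<lambda>t. N (u + t *\<^sub>R v)) has_real_derivative dN u v) (at 0)"
proof -
  have "((\<lambda>t. u + t *\<^sub>R v) has_vector_derivative v) (at 0)"
    by (auto intro!: derivative_eq_intros)
  from N_along_curve[OF this] show ?thesis using assms by simp
qed

lemma dN_le:
  assumes "u \<noteq> 0"
  shows "dN u v \<le> N v"
proof (rule tendsto_upperbound)
  show "((\<lambda>t. (N (u + t *\<^sub>R v) - N u) / t) \<longlongrightarrow> dN u v) (at_right 0)"
    using N_along_line[OF assms, of v] by (auto simp: DERIV_def intro: tendsto_within_subset)
  have "(N (u + t *\<^sub>R v) - N u) / t \<le> N v" if "t > 0" for t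
    using N_triangle[of u "t *\<^sub>R v"] that by (simp add: N_scale field_simps)
  then show "\<forall>\<^sub>F t in at_right 0. (N (u + t *\<^sub>R v) - N u) / t \<le> N v"
    by (auto simp: eventually_at_filter)
qed auto

lemma dN_abs_le:
  assumes "u \<noteq> 0"
  shows "\<bar>dN u v\<bar> \<le> N v"
  using dN_le[OF assms, of v] dN_le[OF assms, of "- v"] linear_neg[OF dN_linear[OF assms], of v]
  by (simp add: abs_le_iff)

lemma dN_self:
  assumes "u \<noteq> 0"
  shows "dN u u = N u"
proof (rule DERIV_unique)
  show "((\<lambda>t. N (u + t *\<^sub>R u)) has_real_derivative dN u u) (at 0)"
    by (rule N_along_line[OF assms])
  have "\<forall>\<^sub>F t in nhds 0. (1 + t) * N u = N (u + t *\<^sub>R u)"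
  proof -
    have "\<forall>\<^sub>F t in nhds 0. t \<in> {-1<..<1::real}"
      by (rule eventually_nhds_in_open) auto
    then show ?thesis
    proof eventually_elim
      case (elim t)
      have "u + t *\<^sub>R u = (1 + t) *\<^sub>R u" by (simp add: scaleR_add_left)
      then show ?case using elim by (simp only: N_scale) simp
    qed
  qed
  moreover have "((\<lambda>t. (1 + t) * N u) has_real_derivative N u) (at 0)"
    by (auto intro!: derivative_eq_intros)
  ultimately show "((\<lambda>t. N (u + t *\<^sub>R u)) has_real_derivative N u) (at 0)"
    by (simp add: DERIV_cong_ev)
qed

text \<open>
  If \<open>u \<noteq> v\<close>, then \<open>N\<close> is constant on the segment from \<open>u\<close> to \<open>v\<close>. By the identity theorem it is then constant
  on the whole line through these points, which is impossible because a norm is unbounded on lines.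
\<close>

lemma N_strictly_convex:
  assumes eq: "N u = N v" and mid: "N (u + v) = 2 * N u"
  shows "u = v"
proof (rule ccontr)
  assume "u \<noteq> v"
  define m where "m = N u"
  define w where "w = (\<lambda>s. u + s *\<^sub>R (v - u))"
  have w_alt: "w s = (1 - s) *\<^sub>R u + s *\<^sub>R v" for s
    by (simp add: w_def algebra_simps)
  have m0: "m \<noteq> 0"
    using \<open>u \<noteq> v\<close> eq unfolding m_def by (metis N_eq_0_iff)
  \<comment> \<open>the identity theorem needs a line that avoids the origin, where \<open>N\<close> is not analytic\<close>
  have w0: "w s \<noteq> 0" for s
  proof
    assume "w s = 0"
    then have "(1 - s) *\<^sub>R u = - (s *\<^sub>R v)"
      by (simp add: w_alt eq_neg_iff_add_eq_0)
    then have "N ((1 - s) *\<^sub>R u) = N (s *\<^sub>R v)" by simp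
    then have "\<bar>1 - s\<bar> * m = \<bar>s\<bar> * m"
      by (simp only: N_scale m_def eq)
    then have "s = 1/2" using m0 by auto
    then have "w (1/2) = 0" using \<open>w s = 0\<close> by (simp only:)
    then have "(1/2) *\<^sub>R (u + v) = 0"
      by (simp add: w_alt scaleR_add_right)
    then have "u + v = 0" by (simp only: scaleR_eq_0_iff) simp
    then show False using mid m0 by (simp add: m_def)
  qed
  have le: "N (w s) \<le> m" if "s \<in> {0..1}" for s
  proof -
    have "N (w s) \<le> N ((1 - s) *\<^sub>R u) + N (s *\<^sub>R v)"
      unfolding w_alt by (rule N_triangle)
    also have "\<dots> = (1 - s) * m + s * m"
      using that by (simp only: N_scale eq m_def) simp
    also have "\<dots> = m" by (simp add: algebra_simps)
    finally show ?thesis .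
  qed
  have const: "N (w s) = m" if s: "s \<in> {0..1}" for s
  proof -
    have "u + v = w s + w (1 - s)" by (simp add: w_alt algebra_simps)
    then have "2 * m \<le> N (w s) + N (w (1 - s))"
      using N_triangle mid by (metis m_def)
    then show ?thesis using le[of s] le[of "1 - s"] s by auto
  qed
  have "N (w s) - m = 0" for s
  proof (rule complexifies_identity_theorem[of UNIV "\<lambda>s. N (w s) - m" 0])
    show "complexifies (\<lambda>s. N (w s) - m) s" for s
      using w0[of s] unfolding w_def by (intro complexifies_diff N_line complexifies_const)
    have "(0::real) islimpt {0<..<1}" by (simp add: islimpt_greaterThanLessThan1)
    then show "0 islimpt {s. N (w s) - m = 0}"
      by (rule islimpt_subset) (auto simp: const)
  qed auto
  then have "N (w s) = m" for s by (simp add: algebra_simps)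
  moreover have "\<bar>s\<bar> * N (v - u) \<le> N (w s) + m" for s
    using N_triangle[of "w s" "- u"] by (simp add: w_def N_scale m_def)
  ultimately have bound: "\<bar>s\<bar> * N (v - u) \<le> 2 * m" for s by simp
  have "N (v - u) > 0" using \<open>u \<noteq> v\<close> by (intro N_pos) simp
  then show False
    using bound[of "(2 * m + 1) / N (v - u)"] N_nonneg[of u] \<open>u \<noteq> v\<close> by (simp add: m_def)
qed

text \<open>
  By strict convexity a linear functional of dual norm \<open>1\<close> attains its norm at one unit vector only,
  up to sign.
\<close>

lemma dN_eq_N_imp_parallel:
  assumes u: "u \<noteq> 0" and v: "\<bar>dN u v\<bar> = N v"
  shows "wedge u v = 0"
proof -
  have *: "wedge u w = 0" if w: "dN u w = N w" for w
  proof (cases "w = 0")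
    case False
    define c where "c = N u / N w"
    have c: "c > 0" using u False by (simp add: c_def N_pos)
    have Nc: "N (c *\<^sub>R w) = N u" using False c by (simp add: N_scale) (simp add: c_def)
    have "dN u (u + c *\<^sub>R w) = 2 * N u"
      using w Nc c by (simp add: dN_self u linear_add[OF dN_linear] linear_cmul[OF dN_linear] N_scale)
    then have "N (u + c *\<^sub>R w) = 2 * N u"
      using dN_le[OF u, of "u + c *\<^sub>R w"] N_triangle[of u "c *\<^sub>R w"] Nc by simp
    then have "u = c *\<^sub>R w"
      using Nc by (intro N_strictly_convex) auto
    then show ?thesis by (metis mult_zero_right wedge_scale_left wedge_self)
  qed (simp add: wedge_simps)
  show ?thesis
  proof (cases "dN u v \<ge> 0")
    case True
    then show ?thesis using * v by simp
  next
    case False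
    then have "dN u (- v) = N (- v)"
      using v by (simp add: linear_neg[OF dN_linear[OF u]])
    from *[OF this] show ?thesis by (simp add: wedge_simps)
  qed
qed

text \<open>
  In a plane two functionals with a common zero \<open>v\<close> are proportional, and both have dual norm \<open>1\<close>, so
  they agree up to sign; the claim is then that of \<open>dN_eq_N_imp_parallel\<close>. This is the reason for the
  regularity of the bipolar coordinates introduced below.
\<close>

lemma dN_common_kernel_imp_parallel:
  assumes p: "p \<noteq> 0" and q: "q \<noteq> 0" and v: "v \<noteq> 0" "dN p v = 0" "dN q v = 0"
  shows "wedge p q = 0"
proof -
  have "wedge v q \<noteq> 0"
  proof
    assume "wedge v q = 0"
    then obtain s where "q = s *\<^sub>R v" using v(1) by (rule wedge_eq_0D)
    then have "dN q q = 0" using v(3) linear_cmul[OF dN_linear[OF q]] by simp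
    then show False using dN_self[OF q] q by simp
  qed
  then have qv: "wedge q v \<noteq> 0" by (simp add: wedge_commute[of v q])
  define \<alpha> where "\<alpha> = wedge p v / wedge q v"
  obtain \<beta> where pq: "p = \<alpha> *\<^sub>R q + \<beta> *\<^sub>R v"
    unfolding \<alpha>_def using wedge_decompose[OF qv, of p] by blast
  have "dN q p = \<alpha> * N q"
    by (subst pq) (simp add: linear_add[OF dN_linear[OF q]] linear_cmul[OF dN_linear[OF q]] v dN_self q)
  moreover have "N p = \<alpha> * dN p q"
  proof -
    have "N p = dN p (\<alpha> *\<^sub>R q + \<beta> *\<^sub>R v)" using dN_self[OF p] pq by simp
    then show ?thesis
      by (simp add: linear_add[OF dN_linear[OF p]] linear_cmul[OF dN_linear[OF p]] v)
  qed
  moreover have "\<bar>\<alpha>\<bar> * \<bar>dN p q\<bar> \<le> \<bar>\<alpha>\<bar> * N q"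
    by (intro mult_left_mono dN_abs_le p) simp
  ultimately have "N p \<le> \<bar>dN q p\<bar>"
    by (metis N_nonneg abs_mult abs_of_nonneg)
  then have "\<bar>dN q p\<bar> = N p"
    using dN_abs_le[OF q, of p] by simp
  then have "wedge q p = 0" by (rule dN_eq_N_imp_parallel[OF q])
  then show ?thesis by (simp add: wedge_commute[of q p])
qed

text \<open>
  Equality in the triangle inequality makes the supporting functional at \<open>p + q\<close> attain its norm at
  \<open>p\<close> as well.
\<close>

lemma N_add_eq_imp_parallel:
  assumes "N (p + q) = N p + N q"
  shows "wedge p q = 0"
proof (cases "p + q = 0")
  case True
  then have "q = - p" by (simp add: eq_neg_iff_add_eq_0 add.commute)
  then show ?thesis by (simp add: wedge_simps)
next
  case False
  have "dN (p + q) p + dN (p + q) q = N p + N q"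
    using dN_self[OF False] assms linear_add[OF dN_linear[OF False]] by simp
  then have "dN (p + q) p = N p"
    using dN_le[OF False, of p] dN_le[OF False, of q] by simp
  then have "wedge (p + q) p = 0"
    by (intro dN_eq_N_imp_parallel[OF False]) simp
  then show ?thesis by (simp add: wedge_simps wedge_commute[of p q])
qed


section \<open>Bipolar coordinates\<close>

text \<open>
  Bipolar coordinates with foci \<open>0\<close> and \<open>c\<close>. A rotation keeps the coordinates of a point while the
  second focus moves.
\<close>

definition bipolar :: "real ^ 2 \<Rightarrow> real ^ 2 \<Rightarrow> real \<times> real" where
  "bipolar c x = (N x, N (x - c))"

text \<open>
  The points of the line through \<open>0\<close> and \<open>c\<close> are recognised by their bipolar coordinates, because
  there one of the triangle inequalities between the two distances and \<open>N c\<close> is an equality.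
\<close>

lemma bipolar_collinear:
  assumes "z \<noteq> 0" "N c = N z" "bipolar c w = bipolar z x" "wedge c w = 0"
  shows "wedge z x = 0"
proof -
  have "c \<noteq> 0" using assms(1,2) by (metis N_eq_0_iff)
  with assms(4) obtain s where w: "w = s *\<^sub>R c" by (rule wedge_eq_0D)
  have "w - c = (s - 1) *\<^sub>R c" by (simp add: w algebra_simps)
  then have x: "N x = \<bar>s\<bar> * N z" "N (x - z) = \<bar>s - 1\<bar> * N z"
    using assms(2,3) w by (auto simp: bipolar_def N_scale)
  consider "s < 0" | "0 \<le> s" "s \<le> 1" | "1 < s" by linarith
  then show ?thesis
  proof cases
    case 1
    then have "N (x + (- z)) = N x + N (- z)" using x by (simp add: algebra_simps)
    from N_add_eq_imp_parallel[OF this] show ?thesis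
      by (simp add: wedge_simps wedge_commute[of z x])
  next
    case 2
    then have "N (x + (z - x)) = N x + N (z - x)"
      using x by (simp add: N_minus_commute[of z x] algebra_simps)
    from N_add_eq_imp_parallel[OF this] show ?thesis
      by (simp add: wedge_simps wedge_commute[of z x])
  next
    case 3
    then have "N ((x - z) + z) = N (x - z) + N z" using x by (simp add: algebra_simps)
    from N_add_eq_imp_parallel[OF this] show ?thesis
      by (simp add: wedge_simps wedge_commute[of z x])
  qed
qed

text \<open>
  Radial projection of the line \<open>s \<mapsto> u + s v\<close> onto the circle of radius \<open>a\<close>. Near any of its points a
  circle has an analytic parametrization of this form.
\<close>

definition radial :: "real \<Rightarrow> real ^ 2 \<Rightarrow> real ^ 2 \<Rightarrow> real \<Rightarrow> real ^ 2" where
  "radial a u v s = (a / N (u + s *\<^sub>R v)) *\<^sub>R (u + s *\<^sub>R v)"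

context
  fixes a :: real and u v :: "real ^ 2"
  assumes a: "a > 0" and uv: "wedge u v \<noteq> 0"
begin

lemma radial_line_nonzero: "u + s *\<^sub>R v \<noteq> 0"
proof
  assume "u + s *\<^sub>R v = 0"
  then have "wedge (u + s *\<^sub>R v) v = 0" by (simp add: wedge_simps)
  then show False using uv by (simp add: wedge_simps)
qed

lemma N_radial: "N (radial a u v s) = a"
  using a radial_line_nonzero[of s] by (simp add: radial_def N_scale)

lemma radial_nonzero: "radial a u v s \<noteq> 0"
  using N_radial[of s] a by fastforce

lemma complexifies_radial: "complexifies (\<lambda>t. radial a u v t $ i) s"
  using radial_line_nonzero[of s] unfolding radial_def
  by (auto intro!: complexifies_add complexifies_mult complexifies_divide N_line)

lemma radial_derivative:
  obtains p' where "(radial a u v has_vector_derivative p') (at s)" "p' \<noteq> 0" "dN (radial a u v s) p' = 0"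
proof -
  define \<rho> where "\<rho> = (\<lambda>t. a / N (u + t *\<^sub>R v))"
  have "complexifies \<rho> s"
    unfolding \<rho>_def using radial_line_nonzero[of s]
    by (intro complexifies_divide N_line) auto
  then obtain d where d: "(\<rho> has_real_derivative d) (at s)"
    by (rule complexifies_differentiable)
  define p' where "p' = d *\<^sub>R (u + s *\<^sub>R v) + \<rho> s *\<^sub>R v"
  have "((\<lambda>t. u + t *\<^sub>R v) has_vector_derivative v) (at s)"
    by (auto intro!: derivative_eq_intros)
  then have "((\<lambda>t. \<rho> t *\<^sub>R (u + t *\<^sub>R v)) has_vector_derivative \<rho> s *\<^sub>R v + d *\<^sub>R (u + s *\<^sub>R v)) (at s)"
    using d by (intro has_vector_derivative_scaleR)
  then have deriv: "(radial a u v has_vector_derivative p') (at s)"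
    unfolding radial_def[abs_def] \<rho>_def[symmetric] p'_def by (simp add: add.commute \<rho>_def)
  have "wedge (u + s *\<^sub>R v) p' = \<rho> s * wedge u v"
    by (simp add: p'_def wedge_simps)
  moreover have "\<rho> s \<noteq> 0"
    using a radial_line_nonzero[of s] by (simp add: \<rho>_def)
  ultimately have "p' \<noteq> 0" using uv by (auto simp: wedge_simps)
  moreover have "dN (radial a u v s) p' = 0"
  proof (rule DERIV_unique)
    show "((\<lambda>t. N (radial a u v t)) has_real_derivative dN (radial a u v s) p') (at s)"
      by (rule N_along_curve[OF deriv radial_nonzero])
  qed (simp add: N_radial)
  ultimately show ?thesis using deriv that by blast
qed

text \<open>
  The tangent \<open>p'\<close> of the circle is in the kernel of \<open>dN x\<close>. If it were in the kernel of \<open>dN (x - c)\<close> as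
  well, \<open>x\<close> and \<open>c\<close> would be parallel.
\<close>

lemma distance_along_radial:
  assumes "wedge c (radial a u v s) \<noteq> 0"
  obtains d where "((\<lambda>t. N (radial a u v t - c)) has_real_derivative d) (at s)" "d \<noteq> 0"
proof -
  let ?x = "radial a u v s"
  obtain p' where p': "(radial a u v has_vector_derivative p') (at s)" "p' \<noteq> 0" "dN ?x p' = 0"
    by (rule radial_derivative)
  have w: "wedge ?x (?x - c) \<noteq> 0"
    using assms by (simp add: wedge_simps wedge_commute[of c])
  then have xc: "?x - c \<noteq> 0" by (metis wedge_zero(2))
  have "((\<lambda>t. radial a u v t - c) has_vector_derivative p') (at s)"
    using p'(1) by (auto intro!: derivative_eq_intros)
  then have "((\<lambda>t. N (radial a u v t - c)) has_real_derivative dN (?x - c) p') (at s)"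
    using xc by (rule N_along_curve)
  moreover have "dN (?x - c) p' \<noteq> 0"
    using dN_common_kernel_imp_parallel[OF radial_nonzero xc p'(2,3)] w by blast
  ultimately show ?thesis by (rule that)
qed

end

text \<open>
  Two points of a half-plane at the same distance from \<open>0\<close> are joined in it by a circular arc. If
  their distances to \<open>c\<close> were equal, the distance to \<open>c\<close> would be stationary somewhere on the arc, by
  Rolle's theorem, contrary to \<open>distance_along_radial\<close>.
\<close>

lemma bipolar_inj:
  assumes x: "k * wedge c x > 0" and y: "k * wedge c y > 0" and eq: "bipolar c x = bipolar c y"
  shows "x = y"
proof -
  have Nxy: "N x = N y" "N (x - c) = N (y - c)" using eq by (auto simp: bipolar_def)
  have x0: "x \<noteq> 0" using x by (auto simp: wedge_simps)
  show ?thesis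
  proof (cases "wedge x y = 0")
    case True
    then obtain s where s: "y = s *\<^sub>R x" using x0 by (rule wedge_eq_0D)
    have "\<bar>s\<bar> = 1" using Nxy(1) x0 by (simp add: s N_scale)
    moreover have "s > 0"
    proof -
      have "s * (k * wedge c x) > 0" using y by (simp add: s wedge_simps mult_ac)
      then show ?thesis using x by (simp add: zero_less_mult_iff)
    qed
    ultimately show ?thesis by (simp add: s)
  next
    case False
    then have uv: "wedge x (y - x) \<noteq> 0" by (simp add: wedge_simps)
    have a: "N x > 0" using x0 by (rule N_pos)
    define h where "h = (\<lambda>t. N (radial (N x) x (y - x) t - c))"
    have off: "wedge c (radial (N x) x (y - x) t) \<noteq> 0" if t: "0 \<le> t" "t \<le> 1" for t
    proof -
      have "(1 - t) *\<^sub>R x + t *\<^sub>R y \<in> {x. k * wedge c x > 0}"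
        using t x y by (intro convexD convex_wedge_side) auto
      moreover have "(1 - t) *\<^sub>R x + t *\<^sub>R y = x + t *\<^sub>R (y - x)"
        by (simp add: algebra_simps)
      ultimately have "k * wedge c (x + t *\<^sub>R (y - x)) > 0" by simp
      then show ?thesis
        using a radial_line_nonzero[OF a uv, of t] by (auto simp: radial_def wedge_simps)
    qed
    have h_deriv: "\<exists>d. (h has_real_derivative d) (at t) \<and> d \<noteq> 0" if "0 \<le> t" "t \<le> 1" for t
      using distance_along_radial[OF a uv off[OF that]] unfolding h_def by blast
    have "h 0 = h 1"
      using Nxy a by (simp add: h_def radial_def)
    moreover have "continuous_on {0..1} h"
      by (intro continuous_at_imp_continuous_on) (use h_deriv DERIV_isCont in fastforce)
    moreover have "h differentiable (at t)" if "0 < t" "t < 1" for t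
      using h_deriv[of t] that real_differentiable_def by force
    ultimately obtain t where t: "0 < t" "t < 1" "(h has_real_derivative 0) (at t)"
      using Rolle[of 0 1 h] by auto
    then show ?thesis
      using h_deriv[of t] DERIV_unique by fastforce
  qed
qed

lemma complexifies_isCont_vec:
  fixes p :: "real \<Rightarrow> real ^ 2"
  assumes "\<And>i. complexifies (\<lambda>t. p t $ i) s"
  shows "isCont p s"
  using complexifies_isCont[OF assms] unfolding isCont_def by (intro vec_tendstoI) auto

text \<open>
  When the first coordinate \<open>a\<close> is fixed, the point moves on a circle, and its second coordinate is an
  analytic function of the circle parameter with non-zero derivative. The one-variable inverse
  function theorem therefore applies.
\<close>

lemma bipolar_inverse_analytic_snd:
  assumes K: "\<forall>\<^sub>F t in nhds b. N (K t) = a \<and> N (K t - c) = t \<and> k * wedge c (K t) > 0"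
  shows "complexifies (\<lambda>t. K t $ i) b"
proof -
  define x where "x = K b"
  have x: "N x = a" "N (x - c) = b" "k * wedge c x > 0"
    using eventually_nhds_x_imp_x[OF K] by (auto simp: x_def)
  have xc: "wedge x c \<noteq> 0" using x(3) by (auto simp: wedge_commute[of c x])
  then have "x \<noteq> 0" "x \<noteq> c" by (auto simp: wedge_simps)
  then have a: "a > 0" using x(1) N_pos by blast
  define p where "p = radial a x c"
  have p0: "p 0 = x" using a x(1) by (simp add: p_def radial_def)
  define h where "h = (\<lambda>t. N (p t - c))"
  have p_an: "complexifies (\<lambda>t. p t $ i) s" for i s
    unfolding p_def by (rule complexifies_radial[OF a xc])
  have "complexifies h 0"
    unfolding h_def using p0 \<open>x \<noteq> c\<close> by (intro N_curve) (auto intro!: complexifies_diff p_an)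
  moreover have "wedge c (radial a x c 0) \<noteq> 0"
    using p0 x(3) by (auto simp: p_def)
  then obtain d where "(h has_real_derivative d) (at 0)" "d \<noteq> 0"
    unfolding h_def p_def by (rule distance_along_radial[OF a xc])
  ultimately obtain \<eta> where "complexifies \<eta> (h 0)" "\<eta> (h 0) = 0" "\<forall>\<^sub>F t in nhds (h 0). h (\<eta> t) = t"
    by (rule complexifies_inverse_function)
  then have \<eta>: "complexifies \<eta> b" "\<eta> b = 0" "\<forall>\<^sub>F t in nhds b. h (\<eta> t) = t"
    using p0 x(2) by (auto simp: h_def)
  have p\<eta>: "complexifies (\<lambda>t. p (\<eta> t) $ i) b" for i
    by (rule complexifies_compose[OF \<eta>(1) p_an])
  have "\<forall>\<^sub>F t in nhds b. k * wedge c (p (\<eta> t)) > 0"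
  proof -
    define q where "q = (\<lambda>t. k * wedge c (p (\<eta> t)))"
    have "isCont q b"
      using complexifies_isCont_vec[OF p\<eta>] unfolding q_def wedge_def by (intro continuous_intros) auto
    then have "(q \<longlongrightarrow> q b) (nhds b)"
      unfolding isCont_def by (rule tendsto_at_iff_tendsto_nhds[THEN iffD1])
    moreover have "q b > 0" using x(3) \<eta>(2) p0 by (simp add: q_def)
    ultimately show ?thesis
      unfolding q_def by (rule order_tendstoD(1))
  qed
  with K \<eta>(3) have "\<forall>\<^sub>F t in nhds b. p (\<eta> t) $ i = K t $ i"
  proof eventually_elim
    case (elim t)
    have "p (\<eta> t) = K t"
      using elim N_radial[OF a xc] by (intro bipolar_inj[of k c]) (auto simp: bipolar_def h_def p_def)
    then show ?case by simp
  qed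
  then show ?thesis using p\<eta> by (rule complexifies_cong)
qed

text \<open>
  The reflection \<open>x \<mapsto> c - x\<close> exchanges the two foci and reverses the side.
\<close>

lemma bipolar_inverse_analytic_fst:
  assumes K: "\<forall>\<^sub>F t in nhds a. N (K t) = t \<and> N (K t - c) = b \<and> k * wedge c (K t) > 0"
  shows "complexifies (\<lambda>t. K t $ i) a"
proof -
  have "\<forall>\<^sub>F t in nhds a. N (c - K t) = b \<and> N (c - K t - c) = t \<and> (- k) * wedge c (c - K t) > 0"
    using K by eventually_elim (simp add: N_minus_commute[of c] wedge_simps)
  then have "complexifies (\<lambda>t. (c - K t) $ i) a"
    by (rule bipolar_inverse_analytic_snd)
  then have "complexifies (\<lambda>t. c $ i - (c - K t) $ i) a"
    by (intro complexifies_diff complexifies_const)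
  then show ?thesis by simp
qed

lemma bipolar_has_derivative:
  assumes "wedge c x \<noteq> 0"
  shows "(bipolar c has_derivative (\<lambda>v. (dN x v, dN (x - c) v))) (at x)"
proof -
  have "x \<noteq> 0" "x - c \<noteq> 0" using assms by (auto simp: wedge_simps)
  then have "(N has_derivative dN x) (at x)" "(N has_derivative dN (x - c)) (at (x - c))"
    by (auto intro: N_has_derivative)
  moreover have "((\<lambda>y. y - c) has_derivative (\<lambda>v. v)) (at x)"
    by (auto intro!: derivative_eq_intros)
  ultimately have "((\<lambda>y. N (y - c)) has_derivative (\<lambda>v. dN (x - c) v)) (at x)"
    using has_derivative_compose by fastforce
  then show ?thesis
    unfolding bipolar_def[abs_def] using \<open>(N has_derivative dN x) (at x)\<close> by (rule has_derivative_Pair[rotated])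
qed

lemma bipolar_inverse_differentiable:
  assumes K: "isCont K p" and T: "open T" "p \<in> T" and inv: "\<And>q. q \<in> T \<Longrightarrow> bipolar c (K q) = q"
    and off: "wedge c (K p) \<noteq> 0"
  shows "K differentiable (at p)"
proof -
  define x where "x = K p"
  have x: "x \<noteq> 0" "x - c \<noteq> 0" "wedge x (x - c) \<noteq> 0"
    using off by (auto simp: wedge_simps x_def wedge_commute[of c])
  define L where "L = (\<lambda>v. (dN x v, dN (x - c) v))"
  have L: "(bipolar c has_derivative L) (at (K p))"
    using bipolar_has_derivative[OF off] by (simp add: L_def x_def)
  then have "linear L" by (rule has_derivative_linear)
  moreover have "inj L"
  proof (subst linear_injective_0[OF \<open>linear L\<close>], intro allI impI)
    fix v assume "L v = 0"
    then have "dN x v = 0" "dN (x - c) v = 0" by (auto simp: L_def zero_prod_def)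
    then show "v = 0" using dN_common_kernel_imp_parallel[OF x(1,2)] x(3) by blast
  qed
  ultimately obtain L' where L': "linear L'" "L' \<circ> L = id"
    using linear_injective_left_inverse by blast
  have "(K has_derivative L') (at p)"
    by (rule has_derivative_inverse_basic[OF L _ L'(2) K T inv])
      (use L'(1) linear_conv_bounded_linear in blast)
  then show ?thesis by (auto simp: differentiable_def)
qed

text \<open>
  Removing one point \<open>y\<close> does not disconnect a connected open subset of the plane. The punctured half-plane is
  needed because distances to \<open>y\<close> are not analytic at \<open>y\<close>.
\<close>

lemma bipolar_chart:
  assumes "k \<noteq> 0"
  obtains K where "homeomorphism {x. k * wedge c x > 0} (bipolar c ` {x. k * wedge c x > 0}) (bipolar c) K"
    and "open (bipolar c ` {x. k * wedge c x > 0})" "connected (bipolar c ` ({x. k * wedge c x > 0} - {y}))"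
proof -
  define S where "S = {x. k * wedge c x > 0}"
  have S: "open S" unfolding S_def by (rule open_wedge_side)
  have "convex S" unfolding S_def by (rule convex_wedge_side)
  then have conn: "connected (S - {y})"
    by (intro connected_open_delete S convex_connected) auto
  have cont: "continuous_on A (bipolar c)" for A
    unfolding bipolar_def[abs_def] by (intro continuous_intros)
  have inj: "inj_on (bipolar c) S"
    by (auto simp: inj_on_def S_def intro: bipolar_inj)
  obtain K where "homeomorphism S (bipolar c ` S) (bipolar c) K"
    using invariance_of_domain_homeomorphism[OF S cont _ inj] by auto
  moreover have "open (bipolar c ` S)"
    by (rule invariance_of_domain_gen[OF S cont inj]) simp
  moreover have "connected (bipolar c ` (S - {y}))"
    by (intro connected_continuous_image cont conn)
  ultimately show ?thesis using that unfolding S_def by blast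
qed

end

section \<open>Rotations in bipolar coordinates\<close>

lemma wedge_linear_image:
  assumes "linear L"
  shows "wedge (L u) (L v) = wedge (L (axis 1 1)) (L (axis 2 1)) * wedge u v"
proof -
  have Lw: "L w = w $ 1 *\<^sub>R L (axis 1 1) + w $ 2 *\<^sub>R L (axis 2 1)" for w
  proof -
    have "w = w $ 1 *\<^sub>R axis 1 1 + w $ 2 *\<^sub>R axis 2 1"
      by (simp add: vec_eq_iff forall_2 axis_def)
    then have "L w = L (w $ 1 *\<^sub>R axis 1 1 + w $ 2 *\<^sub>R axis 2 1)"
      by (rule arg_cong)
    then show ?thesis
      by (simp only: linear_add[OF assms] linear_cmul[OF assms])
  qed
  show ?thesis
    unfolding Lw[of u] Lw[of v] wedge_def by (simp add: algebra_simps)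
qed

lemma has_vector_derivative_along_line:
  fixes \<rho> :: "'b::real_normed_vector \<Rightarrow> 'c::real_normed_vector"
  assumes L: "(\<rho> has_derivative L) (at y)"
  shows "((\<lambda>t. \<rho> (y + t *\<^sub>R v)) has_vector_derivative L v) (at 0)"
proof -
  have line: "((\<lambda>t. y + t *\<^sub>R v) has_vector_derivative v) (at 0)"
    by (auto intro!: derivative_eq_intros)
  have "((\<lambda>t. \<rho> (y + t *\<^sub>R v)) has_derivative (\<lambda>t. L (t *\<^sub>R v))) (at 0)"
    using has_derivative_compose[OF line[unfolded has_vector_derivative_def], of \<rho> L] L by simp
  then show ?thesis
    using has_derivative_linear[OF L] by (simp add: has_vector_derivative_def linear_cmul)
qed

context analytic_plane_norm begin

text \<open>
  The version of \<open>dN_eq_N_imp_parallel\<close> in which the sign and the length are known.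
\<close>

lemma dN_eq_imp_eq:
  assumes "u \<noteq> 0" "N v = N u" "dN u v = N u"
  shows "v = u"
proof -
  have "wedge u v = 0" by (rule dN_eq_N_imp_parallel) (use assms in auto)
  then obtain s where s: "v = s *\<^sub>R u" using assms(1) by (rule wedge_eq_0D)
  then have "s * N u = N u"
    using assms dN_self linear_cmul[OF dN_linear] by simp
  then show ?thesis using s assms(1) by simp
qed

lemma derivative_of_distance_preserving:
  assumes L: "(\<rho> has_derivative L) (at y)"
    and iso: "\<forall>\<^sub>F x in nhds y. N (\<rho> x - \<rho> y) = N (x - y)"
  shows "N (L v) = N v"
proof -
  have "((\<lambda>t. \<rho> (y + t *\<^sub>R v)) has_vector_derivative L v) (at 0)"
    using L by (rule has_vector_derivative_along_line)
  then have "((\<lambda>t. \<rho> (y + t *\<^sub>R v) $ i) has_real_derivative L v $ i) (at 0)" for i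
    by (simp add: has_real_derivative_iff_has_vector_derivative
        bounded_linear.has_vector_derivative[OF bounded_linear_vec_nth])
  then have "((\<lambda>t. (\<rho> (y + t *\<^sub>R v) - \<rho> y) /\<^sub>R t) \<longlongrightarrow> L v) (at 0)"
    by (intro vec_tendstoI) (simp add: DERIV_def divide_inverse mult.commute)
  then have lim: "((\<lambda>t. N ((\<rho> (y + t *\<^sub>R v) - \<rho> y) /\<^sub>R t)) \<longlongrightarrow> N (L v)) (at 0)"
    by (rule isCont_tendsto_compose[OF isCont_N])
  have "((\<lambda>t. y + t *\<^sub>R v) \<longlongrightarrow> y) (at 0)"
    by (rule tendsto_eq_intros refl | simp)+
  with iso have "\<forall>\<^sub>F t in at 0. N (\<rho> (y + t *\<^sub>R v) - \<rho> y) = N (y + t *\<^sub>R v - y)"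
    by (rule eventually_compose_filterlim)
  moreover have "\<forall>\<^sub>F t in at 0. t \<noteq> (0::real)"
    by (simp add: eventually_at_filter)
  ultimately have "\<forall>\<^sub>F t in at 0. N ((\<rho> (y + t *\<^sub>R v) - \<rho> y) /\<^sub>R t) = N v"
    by eventually_elim (simp add: N_scale)
  then have "((\<lambda>t. N ((\<rho> (y + t *\<^sub>R v) - \<rho> y) /\<^sub>R t)) \<longlongrightarrow> N v) (at 0)"
    by (rule tendsto_eventually)
  with lim show ?thesis
    using tendsto_unique trivial_limit_at by blast
qed

lemma dN_derivative:
  assumes L: "(\<rho> has_derivative L) (at y)" and y: "y \<noteq> a" "\<rho> y \<noteq> b"
    and eq: "\<And>x. N (\<rho> x - b) = N (x - a)"
  shows "dN (\<rho> y - b) (L v) = dN (y - a) v"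
proof (rule DERIV_unique)
  have "((\<lambda>t. \<rho> (y + t *\<^sub>R v)) has_vector_derivative L v) (at 0)"
    using L by (rule has_vector_derivative_along_line)
  then have "((\<lambda>t. \<rho> (y + t *\<^sub>R v) - b) has_vector_derivative L v) (at 0)"
    by (auto intro!: derivative_eq_intros)
  from N_along_curve[OF this] y(2)
  have "((\<lambda>t. N (\<rho> (y + t *\<^sub>R v) - b)) has_real_derivative dN (\<rho> y - b) (L v)) (at 0)"
    by simp
  then show "((\<lambda>t. N (y - a + t *\<^sub>R v)) has_real_derivative dN (\<rho> y - b) (L v)) (at 0)"
    by (simp add: eq algebra_simps)
  show "((\<lambda>t. N (y - a + t *\<^sub>R v)) has_real_derivative dN (y - a) v) (at 0)"
    using y(1) by (intro N_along_line) simp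
qed

end

text \<open>
  What a single rotation \<open>x \<mapsto> r x t\<close> satisfies, in coordinates: \<open>c\<close> is the image of \<open>z\<close>, and the map takes
  either side of the line through \<open>0\<close> and \<open>z\<close> to the corresponding side of the line through \<open>0\<close> and \<open>c\<close>.
  So \<open>\<rho>\<close> carries bipolar coordinates with foci \<open>0\<close>, \<open>z\<close> to those with foci \<open>0\<close>, \<open>c\<close>.
\<close>

locale plane_rotation = analytic_plane_norm +
  fixes z c :: "real ^ 2" and \<rho> :: "real ^ 2 \<Rightarrow> real ^ 2"
  assumes z_nonzero: "z \<noteq> 0" and N_c: "N c = N z"
    and cont_\<rho>: "continuous_on UNIV \<rho>"
    and N_\<rho>: "\<And>x. N (\<rho> x) = N x"
    and N_\<rho>_c: "\<And>x. N (\<rho> x - c) = N (x - z)"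
    and side_\<rho>: "\<And>x. wedge z x \<noteq> 0 \<Longrightarrow> wedge z x * wedge c (\<rho> x) > 0"
begin

lemma bipolar_\<rho>: "bipolar c (\<rho> x) = bipolar z x"
  by (simp add: bipolar_def N_\<rho> N_\<rho>_c)

lemma \<rho>_side:
  assumes "k * wedge z x > 0"
  shows "k * wedge c (\<rho> x) > 0"
  using side_\<rho>[of x] assms by (auto simp: zero_less_mult_iff)

lemma \<rho>_inj:
  assumes "k * wedge z x > 0" "k * wedge z y > 0" "\<rho> x = \<rho> y"
  shows "x = y"
  using bipolar_inj[OF assms(1,2)] bipolar_\<rho> assms(3) by metis

lemma \<rho>_differentiable:
  assumes y: "wedge z y \<noteq> 0"
  shows "\<rho> differentiable (at y)"
proof -
  define S where "S = {x. wedge z y * wedge z x > 0}"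
  have yS: "y \<in> S" using y by (simp add: S_def flip: power2_eq_square)
  obtain K where K: "homeomorphism S (bipolar z ` S) (bipolar z) K" and op: "open (bipolar z ` S)"
    unfolding S_def by (rule bipolar_chart[OF y])
  have KF: "K (bipolar z x) = x" if "x \<in> S" for x
    using K that by (simp add: homeomorphism_def)
  have "continuous_on (bipolar z ` S) K"
    using K by (simp add: homeomorphism_def)
  then have "continuous_on (bipolar z ` S) (\<lambda>q. \<rho> (K q))"
    by (rule continuous_on_compose2[OF cont_\<rho>]) simp
  then have "isCont (\<lambda>q. \<rho> (K q)) (bipolar z y)"
    using op yS by (simp add: continuous_on_eq_continuous_at)
  moreover have "bipolar c (\<rho> (K q)) = q" if "q \<in> bipolar z ` S" for q
    using that KF by (auto simp: bipolar_\<rho>)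
  moreover have "wedge c (\<rho> (K (bipolar z y))) \<noteq> 0"
    using side_\<rho>[OF y] KF[OF yS] by auto
  ultimately have "(\<lambda>q. \<rho> (K q)) differentiable (at (bipolar z y))"
    using op yS by (intro bipolar_inverse_differentiable[where T = "bipolar z ` S"]) auto
  then obtain D where D: "((\<lambda>q. \<rho> (K q)) has_derivative D) (at (bipolar z y))"
    by (auto simp: differentiable_def)
  obtain E where E: "(bipolar z has_derivative E) (at y)"
    using bipolar_has_derivative[OF y] by blast
  have "((\<lambda>x. \<rho> (K (bipolar z x))) has_derivative (\<lambda>v. D (E v))) (at y)"
    using has_derivative_compose[OF E D] .
  then have "(\<rho> has_derivative (\<lambda>v. D (E v))) (at y)"
  proof (rule has_derivative_transform_within_open)
    show "open S" unfolding S_def by (rule open_wedge_side)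
  qed (use yS KF in auto)
  then show ?thesis by (auto simp: differentiable_def)
qed

text \<open>
  Let \<open>L\<close> be the derivative of \<open>\<rho>\<close> at \<open>y\<close>. It preserves the norm, since \<open>\<rho>\<close> preserves distances to \<open>y\<close>.
  Differentiating \<open>N (\<rho> x) = N x\<close> at \<open>y\<close> shows that the supporting functional at \<open>\<rho> y\<close> attains its norm at
  \<open>L y\<close>, so that \<open>L y = \<rho> y\<close> by strict convexity. In the same way \<open>N (\<rho> x - c) = N (x - z)\<close> yields
  \<open>L (y - z) = \<rho> y - c\<close>, whence \<open>L z = c\<close>. Thus \<open>L x\<close> and \<open>\<rho> x\<close> have the same bipolar coordinates for foci
  \<open>0\<close>, \<open>c\<close> and lie on the same side, so that \<open>\<rho> = L\<close>.
\<close>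

lemma isometry_if_locally_preserves_distance:
  assumes y: "wedge z y \<noteq> 0" and iso: "\<forall>\<^sub>F x in nhds y. N (\<rho> x - \<rho> y) = N (x - y)"
  shows "N (\<rho> u - \<rho> v) = N (u - v)"
proof -
  have y0: "y \<noteq> 0" "y \<noteq> z" using y by (auto simp: wedge_simps)
  have \<rho>y0: "\<rho> y \<noteq> 0" "\<rho> y \<noteq> c"
    using side_\<rho>[OF y] by (auto simp: wedge_simps)
  obtain L where L: "(\<rho> has_derivative L) (at y)"
    using \<rho>_differentiable[OF y] by (auto simp: differentiable_def)
  have lin: "linear L" using L by (rule has_derivative_linear)
  have NL: "N (L v) = N v" for v
    by (rule derivative_of_distance_preserving[OF L iso])
  have "dN (\<rho> y - 0) (L y) = dN (y - 0) y"
    using y0 \<rho>y0 by (intro dN_derivative[OF L]) (auto simp: N_\<rho>)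
  then have Ly: "L y = \<rho> y"
    using y0 \<rho>y0 by (intro dN_eq_imp_eq) (auto simp: NL N_\<rho> dN_self)
  have "dN (\<rho> y - c) (L (y - z)) = dN (y - z) (y - z)"
    using y0 \<rho>y0 by (intro dN_derivative[OF L]) (auto simp: N_\<rho>_c)
  then have "L (y - z) = \<rho> y - c"
    using y0 \<rho>y0 by (intro dN_eq_imp_eq) (auto simp: NL N_\<rho>_c dN_self)
  then have Lz: "L z = c"
    using Ly linear_diff[OF lin, of y z] by simp
  define \<delta> where "\<delta> = wedge (L (axis 1 1)) (L (axis 2 1))"
  have \<delta>: "wedge (L u) (L v) = \<delta> * wedge u v" for u v
    unfolding \<delta>_def by (rule wedge_linear_image[OF lin])
  have "\<delta> * (wedge z y)\<^sup>2 > 0"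
    using side_\<rho>[OF y] \<delta>[of z y] by (simp add: Lz Ly power2_eq_square mult_ac)
  then have \<delta>_pos: "\<delta> > 0" using y by (simp add: zero_less_mult_iff)
  have off_line: "\<rho> x = L x" if x: "wedge z x \<noteq> 0" for x
  proof (rule bipolar_inj)
    show "wedge z x * wedge c (\<rho> x) > 0" by (rule side_\<rho>[OF x])
    have "wedge z x * wedge c (L x) = \<delta> * (wedge z x)\<^sup>2"
      using \<delta>[of z x] by (simp add: Lz power2_eq_square)
    then show "wedge z x * wedge c (L x) > 0" using \<delta>_pos x by simp
    have "L x - c = L (x - z)" by (simp add: linear_diff[OF lin] Lz)
    then show "bipolar c (\<rho> x) = bipolar c (L x)"
      by (simp add: bipolar_\<rho>) (simp add: bipolar_def NL)
  qed
  \<comment> \<open>both maps are continuous, and a point of the line is a limit of points off it\<close>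
  have "\<rho> x = L x" for x
  proof (cases "wedge z x = 0")
    case True
    have path: "((\<lambda>t. x + t *\<^sub>R y) \<longlongrightarrow> x) (at (0::real))"
      by (rule tendsto_eq_intros refl | simp)+
    have "isCont \<rho> x" using cont_\<rho> by (simp add: continuous_on_eq_continuous_at)
    then have "((\<lambda>t. \<rho> (x + t *\<^sub>R y)) \<longlongrightarrow> \<rho> x) (at 0)"
      using path by (rule isCont_tendsto_compose)
    moreover have "\<rho> (x + t *\<^sub>R y) = L (x + t *\<^sub>R y)" if "t \<noteq> 0" for t
      using True y that by (intro off_line) (simp add: wedge_simps)
    then have "\<forall>\<^sub>F t in at (0::real). \<rho> (x + t *\<^sub>R y) = L (x + t *\<^sub>R y)"
      by (simp add: eventually_at_filter)
    ultimately have "((\<lambda>t. L (x + t *\<^sub>R y)) \<longlongrightarrow> \<rho> x) (at 0)"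
      by (rule Lim_transform_eventually)
    moreover have "isCont L x" using lin by (rule linear_continuous_at[OF linear_conv_bounded_linear[THEN iffD1]])
    then have "((\<lambda>t. L (x + t *\<^sub>R y)) \<longlongrightarrow> L x) (at 0)"
      using path by (rule isCont_tendsto_compose)
    ultimately show ?thesis
      using tendsto_unique trivial_limit_at by blast
  qed (rule off_line)
  then show ?thesis
    by (simp add: NL flip: linear_diff[OF lin])
qed

text \<open>
  In bipolar coordinates \<open>x\<close> and \<open>\<rho> x\<close> have the same two coordinates (for different foci), and each
  depends analytically on either coordinate when the other one is fixed. Hence so does
  \<open>N (\<rho> x - \<rho> y) - N (x - y)\<close>, as long as \<open>x \<noteq> y\<close>, and \<open>separately_analytic_zeros\<close> applies. The inverse
  \<open>K\<close> of the chart is differentiable and so takes null sets back to null sets.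
\<close>

lemma distance_preserved_negligible_or_everywhere:
  assumes y: "k * wedge z y > 0"
  shows "negligible {x. k * wedge z x > 0 \<and> N (\<rho> x - \<rho> y) = N (x - y)} \<or>
    (\<forall>x. k * wedge z x > 0 \<longrightarrow> N (\<rho> x - \<rho> y) = N (x - y))"
proof -
  define S where "S = {x. k * wedge z x > 0}"
  have k: "k \<noteq> 0" using y by auto
  have S: "open S" "y \<in> S" using y by (auto simp: S_def intro: open_wedge_side)
  obtain K where K: "homeomorphism S (bipolar z ` S) (bipolar z) K" and op: "open (bipolar z ` S)"
    and conn: "connected (bipolar z ` (S - {y}))"
    unfolding S_def by (rule bipolar_chart[OF k])
  have KF: "K (bipolar z x) = x" if "x \<in> S" for x
    using K that by (simp add: homeomorphism_def)
  have FK: "K p \<in> S" "bipolar z (K p) = p" if "p \<in> bipolar z ` S" for p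
    using that KF by auto
  define \<Omega> where "\<Omega> = bipolar z ` (S - {y})"
  have inj: "inj_on (bipolar z) S"
    using KF by (rule inj_on_inverseI)
  have \<Omega>_alt: "\<Omega> = bipolar z ` S - {bipolar z y}"
    using inj_on_image_set_diff[OF inj, of S "{y}"] S(2) by (simp add: \<Omega>_def)
  have open_\<Omega>: "open \<Omega>" unfolding \<Omega>_alt using op by (intro open_delete)
  have K\<Omega>: "K p \<in> S" "K p \<noteq> y" "bipolar z (K p) = p" if "p \<in> \<Omega>" for p
    using that FK KF by (auto simp: \<Omega>_def)
  have contK: "continuous_on \<Omega> K"
    using homeomorphism_cont2[OF K] by (rule continuous_on_subset) (auto simp: \<Omega>_def)
  have \<rho>y: "\<rho> (K p) \<noteq> \<rho> y" if "p \<in> \<Omega>" for p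
    using \<rho>_inj[of k "K p" y] K\<Omega>[OF that] y by (auto simp: S_def)
  define g where "g = (\<lambda>p. N (\<rho> (K p) - \<rho> y) - N (K p - y))"
  have near_fst: "\<forall>\<^sub>F t in nhds a. (t, b) \<in> \<Omega>" and near_snd: "\<forall>\<^sub>F t in nhds b. (a, t) \<in> \<Omega>"
    if "(a, b) \<in> \<Omega>" for a b
  proof -
    have "((\<lambda>t. (t, b)) \<longlongrightarrow> (a, b)) (nhds a)" "((\<lambda>t. (a, t)) \<longlongrightarrow> (a, b)) (nhds b)"
      by (intro tendsto_Pair tendsto_const filterlim_ident)+
    then show "\<forall>\<^sub>F t in nhds a. (t, b) \<in> \<Omega>" "\<forall>\<^sub>F t in nhds b. (a, t) \<in> \<Omega>"
      using topological_tendstoD[OF _ open_\<Omega> that] by auto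
  qed
  have K_in: "N (K (s, t)) = s \<and> N (K (s, t) - z) = t \<and> k * wedge z (K (s, t)) > 0"
    and \<rho>K_in: "N (\<rho> (K (s, t))) = s \<and> N (\<rho> (K (s, t)) - c) = t \<and> k * wedge c (\<rho> (K (s, t))) > 0"
    if "(s, t) \<in> \<Omega>" for s t
    using K\<Omega>[OF that] by (auto simp: bipolar_def S_def N_\<rho> N_\<rho>_c intro: \<rho>_side)
  have zeros: "(\<forall>p\<in>\<Omega>. g p = 0) \<or> negligible {p\<in>\<Omega>. g p = 0}"
  proof (rule separately_analytic_zeros[OF open_\<Omega>])
    show "connected \<Omega>" unfolding \<Omega>_def by (rule conn)
    fix a b assume ab: "(a, b) \<in> \<Omega>"
    show "complexifies (\<lambda>t. g (t, b)) a"
      unfolding g_def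
    proof (intro complexifies_diff N_curve)
      show "complexifies (\<lambda>t. (\<rho> (K (t, b)) - \<rho> y) $ i) a" for i
        using bipolar_inverse_analytic_fst[OF eventually_mono[OF near_fst[OF ab] \<rho>K_in]]
        by (auto intro: complexifies_diff)
      show "complexifies (\<lambda>t. (K (t, b) - y) $ i) a" for i
        using bipolar_inverse_analytic_fst[OF eventually_mono[OF near_fst[OF ab] K_in]]
        by (auto intro: complexifies_diff)
    qed (use K\<Omega>[OF ab] \<rho>y[OF ab] in auto)
    show "complexifies (\<lambda>t. g (a, t)) b"
      unfolding g_def
    proof (intro complexifies_diff N_curve)
      show "complexifies (\<lambda>t. (\<rho> (K (a, t)) - \<rho> y) $ i) b" for i
        using bipolar_inverse_analytic_snd[OF eventually_mono[OF near_snd[OF ab] \<rho>K_in]]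
        by (auto intro: complexifies_diff)
      show "complexifies (\<lambda>t. (K (a, t) - y) $ i) b" for i
        using bipolar_inverse_analytic_snd[OF eventually_mono[OF near_snd[OF ab] K_in]]
        by (auto intro: complexifies_diff)
    qed (use K\<Omega>[OF ab] \<rho>y[OF ab] in auto)
  next
    show "continuous_on \<Omega> g"
      unfolding g_def
      by (intro continuous_intros contK continuous_on_compose2[OF cont_\<rho>]) auto
  qed
  show ?thesis
  proof (cases "\<forall>p\<in>\<Omega>. g p = 0")
    case True
    have "N (\<rho> x - \<rho> y) = N (x - y)" if "x \<in> S" for x
    proof (cases "x = y")
      case False
      then have "bipolar z x \<in> \<Omega>" using that by (simp add: \<Omega>_def)
      then show ?thesis using True KF[OF that] by (force simp: g_def)
    qed simp
    then show ?thesis by (auto simp: S_def)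
  next
    case False
    then have "negligible {p\<in>\<Omega>. g p = 0}" using zeros by blast
    moreover have "K differentiable (at p)" if p: "p \<in> \<Omega>" for p
    proof (rule bipolar_inverse_differentiable[OF _ open_\<Omega> p])
      show "isCont K p" using contK open_\<Omega> p by (simp add: continuous_on_eq_continuous_at)
      show "bipolar z (K q) = q" if "q \<in> \<Omega>" for q using K\<Omega>[OF that] by simp
      show "wedge z (K p) \<noteq> 0" using K\<Omega>[OF p] by (auto simp: S_def)
    qed
    then have "K differentiable_on {p\<in>\<Omega>. g p = 0}"
      by (auto simp: differentiable_on_def intro: differentiable_at_withinI)
    ultimately have "negligible (K ` {p\<in>\<Omega>. g p = 0})"
      by (intro negligible_differentiable_image_negligible) auto
    then have "negligible (insert y (K ` {p\<in>\<Omega>. g p = 0}))" by simp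
    moreover have "{x. k * wedge z x > 0 \<and> N (\<rho> x - \<rho> y) = N (x - y)} \<subseteq> insert y (K ` {p\<in>\<Omega>. g p = 0})"
    proof
      fix x assume "x \<in> {x. k * wedge z x > 0 \<and> N (\<rho> x - \<rho> y) = N (x - y)}"
      then have x: "x \<in> S" "N (\<rho> x - \<rho> y) = N (x - y)" by (auto simp: S_def)
      show "x \<in> insert y (K ` {p\<in>\<Omega>. g p = 0})"
      proof (cases "x = y")
        case False
        then have "bipolar z x \<in> {p\<in>\<Omega>. g p = 0}"
          using x KF[OF x(1)] by (auto simp: \<Omega>_def g_def)
        then show ?thesis using KF[OF x(1)] by (metis imageI insertI2)
      qed simp
    qed
    ultimately show ?thesis using negligible_subset by blast
  qed
qed

theorem distance_preserved_negligible_or_isometry: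
  assumes y: "k * wedge z y > 0"
  shows "negligible {x. k * wedge z x > 0 \<and> N (\<rho> x - \<rho> y) = N (x - y)} \<or>
    (\<forall>u v. N (\<rho> u - \<rho> v) = N (u - v))"
proof (rule disj_forward[OF distance_preserved_negligible_or_everywhere[OF y]])
  assume *: "\<forall>x. k * wedge z x > 0 \<longrightarrow> N (\<rho> x - \<rho> y) = N (x - y)"
  have "\<forall>\<^sub>F x in nhds y. x \<in> {x. k * wedge z x > 0}"
    using y by (intro eventually_nhds_in_open open_wedge_side) simp
  then have "\<forall>\<^sub>F x in nhds y. N (\<rho> x - \<rho> y) = N (x - y)"
    by eventually_elim (use * in blast)
  moreover have "wedge z y \<noteq> 0" using y by auto
  ultimately show "\<forall>u v. N (\<rho> u - \<rho> v) = N (u - v)"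
    using isometry_if_locally_preserves_distance by blast
qed

end

section \<open>Normed planes in linear coordinates\<close>

lemma analytic_plane_norm_chart:
  fixes \<phi> :: "real ^ 2 \<Rightarrow> 'a::real_normed_vector"
  assumes \<phi>: "linear_chart \<phi>"
    and an: "\<And>u. \<phi> u \<noteq> 0 \<Longrightarrow> real_analytic_at (\<lambda>u. norm (\<phi> u)) u"
  shows "analytic_plane_norm (\<lambda>u. norm (\<phi> u))"
proof
  have lin: "linear \<phi>" and inj: "inj \<phi>"
    using \<phi> by (auto simp: linear_chart_def bij_is_inj)
  show iff: "norm (\<phi> u) = 0 \<longleftrightarrow> u = 0" for u
    using linear_injective_0[OF lin] inj linear_0[OF lin] by auto
  show "norm (\<phi> (s *\<^sub>R u)) = \<bar>s\<bar> * norm (\<phi> u)" for s u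
    by (simp add: linear_cmul[OF lin])
  show "norm (\<phi> (u + v)) \<le> norm (\<phi> u) + norm (\<phi> v)" for u v
    by (simp add: linear_add[OF lin] norm_triangle_ineq)
  show "complexifies (\<lambda>t. norm (\<phi> (p t))) s"
    if p: "\<And>i. complexifies (\<lambda>t. p t $ i) s" "p s \<noteq> 0" for p s
  proof (rule complexifies_along_curve[where N = "\<lambda>u. norm (\<phi> u)"])
    show "real_analytic_at (\<lambda>u. norm (\<phi> u)) (p s)"
      using iff[of "p s"] p(2) by (intro an) simp
    show "complexifies (\<lambda>u. p u \<bullet> b) s" if "b \<in> Basis" for b
      using that p(1) by (auto simp: Basis_vec_def inner_axis)
  qed
qed

text \<open>
  By compactness the norm of \<open>\<phi> u\<close> has a positive minimum on the Euclidean unit circle.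
\<close>

lemma linear_chart_inverse:
  fixes \<phi> :: "real ^ 2 \<Rightarrow> 'a::real_normed_vector"
  assumes \<phi>: "linear_chart \<phi>"
  shows "bounded_linear (inv \<phi>)"
proof -
  have lin: "linear \<phi>" and bij: "bij \<phi>"
    using \<phi> by (auto simp: linear_chart_def)
  have \<phi>_inv: "\<phi> (inv \<phi> x) = x" for x
    using bij by (simp add: bij_is_surj surj_f_inv_f)
  have cont: "continuous_on A \<phi>" for A
    using lin by (simp add: linear_continuous_on linear_conv_bounded_linear)
  have "sphere (0 :: real ^ 2) 1 \<noteq> {}" by simp
  then obtain w where w: "w \<in> sphere 0 1" "\<And>u. u \<in> sphere 0 1 \<Longrightarrow> norm (\<phi> w) \<le> norm (\<phi> u)"
    using continuous_attains_inf[OF compact_sphere _ continuous_on_norm[OF cont]] by blast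
  define m where "m = norm (\<phi> w)"
  have "\<phi> w \<noteq> 0"
    using w(1) linear_injective_0[OF lin] bij by (auto simp: bij_is_inj)
  then have m: "m > 0" by (simp add: m_def)
  have lower: "m * norm u \<le> norm (\<phi> u)" for u
  proof (cases "u = 0")
    case False
    then have "m \<le> norm (\<phi> (u /\<^sub>R norm u))"
      unfolding m_def by (intro w(2)) simp
    then show ?thesis
      using False by (simp add: linear_cmul[OF lin] field_simps)
  qed (simp add: linear_0[OF lin])
  show ?thesis
  proof (rule bounded_linear_intro)
    have inj: "inj \<phi>" using bij by (rule bij_is_inj)
    show "inv \<phi> (x + y) = inv \<phi> x + inv \<phi> y" for x y
      by (rule injD[OF inj]) (simp add: \<phi>_inv linear_add[OF lin])
    show "inv \<phi> (s *\<^sub>R x) = s *\<^sub>R inv \<phi> x" for s x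
      by (rule injD[OF inj]) (simp add: \<phi>_inv linear_cmul[OF lin])
    show "norm (inv \<phi> x) \<le> norm x * (1 / m)" for x
      using lower[of "inv \<phi> x"] m by (simp add: \<phi>_inv field_simps)
  qed
qed

text \<open>
  A functional on the plane that vanishes at \<open>z\<close> is determined by its value at one vector off the line
  through \<open>0\<close> and \<open>z\<close>.
\<close>

lemma linear_functional_wedge:
  fixes l :: "real ^ 2 \<Rightarrow> real"
  assumes l: "linear l" and z: "z \<noteq> 0" "l z = 0"
  obtains k where "\<And>u. l u = k * wedge z u"
proof -
  define w :: "real ^ 2" where "w = vector [- z $ 2, z $ 1]"
  have "wedge z w = (z $ 1)\<^sup>2 + (z $ 2)\<^sup>2"
    by (simp add: wedge_def w_def power2_eq_square)
  also have "\<dots> \<noteq> 0"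
    using z(1) by (simp add: sum_power2_eq_zero_iff vec_eq_iff forall_2)
  finally have zw: "wedge z w \<noteq> 0" .
  have "l u = (l w / wedge z w) * wedge z u" for u
  proof -
    have "l u = l ((wedge u w / wedge z w) *\<^sub>R z + (wedge z u / wedge z w) *\<^sub>R w)"
      using wedge_decompose[OF zw, of u] by (rule arg_cong)
    then show ?thesis
      by (simp add: linear_add[OF l] linear_cmul[OF l] z(2))
  qed
  then show ?thesis by (rule that)
qed

theorem theorem4p13:
  fixes z :: "'a::real_normed_vector"
    and H :: "'a set"
    and f :: "real \<Rightarrow> 'a"
    and r :: "'a \<Rightarrow> real \<Rightarrow> 'a"
  assumes "dim (UNIV :: 'a set) = 2"
    and "analytic_norm TYPE('a)"
    and "\<not> euclidean_norm TYPE('a)"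
    and "normal_point z"
    and "open_half_plane z H"
    and "circle_parametrization z f"
    and "rotation_about z f r"
  shows "\<exists>Y. comeagre_subset Y H \<and>
    (\<forall>y\<in>Y. \<forall>t. \<not> is_isometry (\<lambda>x. r x t) \<longrightarrow>
      (\<exists>C. open C \<and> conull_subset C H \<and>
        (\<forall>x\<in>C. norm (r x t - r y t) \<noteq> norm (x - y))))"
proof -
  obtain \<phi> :: "real ^ 2 \<Rightarrow> 'a" where chart: "linear_chart \<phi>"
    and an: "\<And>u. \<phi> u \<noteq> 0 \<Longrightarrow> real_analytic_at (\<lambda>u. norm (\<phi> u)) u"
    using assms(2) unfolding analytic_norm_def by blast
  interpret analytic_plane_norm "\<lambda>u. norm (\<phi> u)"
    using chart an by (rule analytic_plane_norm_chart)
  have lin: "linear \<phi>" and bij: "bij \<phi>"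
    using chart by (auto simp: linear_chart_def)
  have cont_\<phi>: "continuous_on A \<phi>" for A
    using lin by (simp add: linear_continuous_on linear_conv_bounded_linear)
  define \<psi> where "\<psi> = inv \<phi>"
  have \<phi>\<psi> [simp]: "\<phi> (\<psi> x) = x" for x
    using bij by (simp add: \<psi>_def bij_is_surj surj_f_inv_f)
  have \<psi>\<phi> [simp]: "\<psi> (\<phi> u) = u" for u
    using bij by (simp add: \<psi>_def bij_is_inj)
  have "bounded_linear \<psi>"
    unfolding \<psi>_def using chart by (rule linear_chart_inverse)
  then have cont_\<psi>: "continuous_on A \<psi>" for A
    by (rule linear_continuous_on)
  have z: "z \<noteq> 0" using assms(4) by (simp add: normal_point_def)
  have z': "\<psi> z \<noteq> 0" using z \<phi>\<psi>[of z] linear_0[OF lin] by metis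
  have cont_r: "continuous_on UNIV (\<lambda>(x, t). r x t)" and r_0: "\<And>x. r x 0 = x"
    and norm_r: "\<And>x t. norm (r x t) = norm x" and norm_r_z: "\<And>x t. norm (r x t - r z t) = norm (x - z)"
    using assms(7) by (auto simp: rotation_about_def)
  have cont_r_x: "continuous_on UNIV (\<lambda>x. r x t)" for t
    using continuous_on_compose2[OF cont_r, of UNIV "\<lambda>x. (x, t)"] by (simp add: continuous_intros)
  have cont_r_t: "continuous_on UNIV (\<lambda>t. r x t)" for x
    using continuous_on_compose2[OF cont_r, of UNIV "\<lambda>t. (x, t)"] by (simp add: continuous_intros)
  define \<rho> where "\<rho> = (\<lambda>t u. \<psi> (r (\<phi> u) t))"
  have bip: "bipolar (\<psi> (r z t)) (\<rho> t u) = bipolar (\<psi> z) u" for t u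
    by (simp add: bipolar_def \<rho>_def linear_diff[OF lin] norm_r norm_r_z)
  have rotation: "plane_rotation (\<lambda>u. norm (\<phi> u)) (\<psi> z) (\<psi> (r z t)) (\<rho> t)" for t
  proof unfold_locales
    show "\<psi> z \<noteq> 0" by (rule z')
    show "continuous_on UNIV (\<rho> t)"
      unfolding \<rho>_def
      by (intro continuous_on_compose2[OF cont_\<psi>] continuous_on_compose2[OF cont_r_x cont_\<phi>]) auto
    fix x assume x: "wedge (\<psi> z) x \<noteq> 0"
    \<comment> \<open>along the rotation the point never crosses the line through \<open>0\<close> and the moving \<open>z\<close>\<close>
    define q where "q = (\<lambda>s. wedge (\<psi> (r z s)) (\<rho> s x))"
    have q0: "q s \<noteq> 0" for s
      using bipolar_collinear[OF z' _ bip[of s x]] x by (auto simp: q_def norm_r)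
    have "continuous_on UNIV q"
      unfolding q_def \<rho>_def
      by (intro continuous_on_wedge continuous_on_compose2[OF cont_\<psi> cont_r_t]) auto
    then have "connected (range q)"
      by (intro connected_continuous_image) auto
    then have "q 0 * q t > 0"
      using q0[of 0] q0[of t] q0 connectedD_interval[of "range q" "q 0" "q t" 0]
        connectedD_interval[of "range q" "q t" "q 0" 0]
      by (auto simp: zero_less_mult_iff not_less) (smt (verit) rangeE)+
    then show "0 < wedge (\<psi> z) x * wedge (\<psi> (r z t)) (\<rho> t x)"
      by (simp add: q_def \<rho>_def r_0)
  qed (simp_all add: \<rho>_def norm_r norm_r_z linear_diff[OF lin])
  obtain l where l: "linear l" "{x. l x = 0} = span {z}" and H: "H = {x. l x > (0::real)}"
    using assms(5) unfolding open_half_plane_def by blast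
  have "l z = 0" using l(2) span_base[of z "{z}"] by blast
  then obtain k where k: "\<And>u. l (\<phi> u) = k * wedge (\<psi> z) u"
    using linear_functional_wedge[of "\<lambda>u. l (\<phi> u)" "\<psi> z"] linear_compose[OF lin l(1)] z'
    by (auto simp: o_def)
  have lk: "l x = k * wedge (\<psi> z) (\<psi> x)" for x
    using k[of "\<psi> x"] by simp
  have cont_l: "continuous_on UNIV l"
    unfolding lk by (intro continuous_intros cont_\<psi>)
  have "\<exists>C. open C \<and> conull_subset C H \<and> (\<forall>x\<in>C. norm (r x t - r y t) \<noteq> norm (x - y))"
    if y: "y \<in> H" and t: "\<not> is_isometry (\<lambda>x. r x t)" for y t
  proof -
    interpret rot: plane_rotation "\<lambda>u. norm (\<phi> u)" "\<psi> z" "\<psi> (r z t)" "\<rho> t"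
      by (rule rotation)
    define Z where "Z = {u. k * wedge (\<psi> z) u > 0 \<and> norm (\<phi> (\<rho> t u - \<rho> t (\<psi> y))) = norm (\<phi> (u - \<psi> y))}"
    have Z: "u \<in> Z \<longleftrightarrow> \<phi> u \<in> H \<and> norm (r (\<phi> u) t - r y t) = norm (\<phi> u - y)" for u
      by (simp add: Z_def H k \<rho>_def linear_diff[OF lin])
    have "\<not> (\<forall>u v. norm (\<phi> (\<rho> t u - \<rho> t v)) = norm (\<phi> (u - v)))"
    proof
      assume *: "\<forall>u v. norm (\<phi> (\<rho> t u - \<rho> t v)) = norm (\<phi> (u - v))"
      have "norm (r x t - r y t) = norm (x - y)" for x y
        using *[rule_format, of "\<psi> x" "\<psi> y"] by (simp add: \<rho>_def linear_diff[OF lin])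
      then show False using t by (simp add: is_isometry_def dist_norm)
    qed
    moreover have "k * wedge (\<psi> z) (\<psi> y) > 0" using y by (simp add: H lk)
    ultimately have "negligible Z"
      using rot.distance_preserved_negligible_or_isometry unfolding Z_def by blast
    define C where "C = {x. l x > 0 \<and> norm (r x t - r y t) \<noteq> norm (x - y)}"
    have "open C"
      unfolding C_def
      by (intro open_Collect_conj open_Collect_less open_Collect_neq continuous_intros cont_l cont_r_x)
    moreover have "conull_subset C H"
      unfolding conull_subset_def lebesgue_null_def
    proof (intro conjI allI impI)
      show "C \<subseteq> H" by (auto simp: C_def H)
      fix \<phi>' :: "real ^ 2 \<Rightarrow> 'a" assume \<phi>': "linear_chart \<phi>'"
      have bij': "bij \<phi>'" using \<phi>' by (simp add: linear_chart_def)
      have "linear (\<lambda>u. inv \<phi>' (\<phi> u))"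
        using linear_compose[OF lin bounded_linear.linear[OF linear_chart_inverse[OF \<phi>']]]
        by (simp add: o_def)
      then have "negligible ((\<lambda>u. inv \<phi>' (\<phi> u)) ` Z)"
        using \<open>negligible Z\<close>
        by (intro negligible_differentiable_image_negligible linear_imp_differentiable_on) auto
      moreover have "\<phi>' -` (H - C) = (\<lambda>u. inv \<phi>' (\<phi> u)) ` Z"
      proof (intro set_eqI iffI)
        fix v assume "v \<in> \<phi>' -` (H - C)"
        then have "\<psi> (\<phi>' v) \<in> Z" by (simp add: Z C_def H)
        moreover have "v = inv \<phi>' (\<phi> (\<psi> (\<phi>' v)))" using bij' by (simp add: bij_is_inj)
        ultimately show "v \<in> (\<lambda>u. inv \<phi>' (\<phi> u)) ` Z" by blast
      next
        fix v assume "v \<in> (\<lambda>u. inv \<phi>' (\<phi> u)) ` Z"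
        then show "v \<in> \<phi>' -` (H - C)"
          using bij' by (auto simp: Z C_def bij_is_surj surj_f_inv_f)
      qed
      ultimately show "\<phi>' -` (H - C) \<in> null_sets lebesgue"
        by (simp add: negligible_iff_null_sets)
    qed
    ultimately show ?thesis by (auto simp: C_def)
  qed
  moreover have "comeagre_subset H H"
    by (auto simp: comeagre_subset_def intro: exI[of _ "{}"])
  ultimately show ?thesis by blast
qed

end
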